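(* Let $\ell_p:\mathbb R^{n_v}\to\mathbb R$, $\ell_p(\mathbf v)=\tfrac12\|\mathbf v-\mathbf v^*\|_{\mathbf A}^2+\tfrac12\|P_{\mathcal F}(\mathbf y(\mathbf v))\|_{\mathbf R}^2$, let $\mathbf v_*$ denote its global minimizer, and let $(\mathbf v_m)_{m\ge0}$ be the iterates of the SAP method (defined in the context). The following statements hold. (1) SAP globally converges from all initial conditions: for every $\mathbf v_0\in\mathbb R^{n_v}$, $\mathbf v_m\to\mathbf v_*$. (2) If $\nabla\ell_p$ is differentiable on the ball $B(\mathbf v_*,r)=\{\mathbf v:\|\mathbf v-\mathbf v_*\|\le r\}$ for some $r>0$, then SAP exhibits quadratic convergence, i.e., for some finite $M$ and some $\zeta>0$, $$\|\mathbf v_{m+1}-\mathbf v_*\|\le\zeta\,\|\mathbf v_m-\mathbf v_*\|^2\qquad\text{for all } m>M.$$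
   Context: Data: $\mathbf A\in\mathbb R^{n_v\times n_v}$ symmetric positive definite; $\mathbf J\in\mathbb R^{3n_c\times n_v}$; $\mathbf v^*\in\mathbb R^{n_v}$; $\hat{\mathbf v}_c\in\mathbb R^{3n_c}$; for each $i=1,\dots,n_c$ a friction coefficient $\mu_i>0$ and $R_i=\mathrm{diag}(R_{t,i},R_{t,i},R_{n,i})$ with $R_{t,i},R_{n,i}>0$; $\mathbf R=\mathrm{diag}(R_1,\dots,R_{n_c})$. For positive definite $\mathbf X$, $\|\mathbf z\|_{\mathbf X}^2=\mathbf z^T\mathbf X\mathbf z$. $\mathcal F=\mathcal F_1\times\cdots\times\mathcal F_{n_c}$ with $\mathcal F_i=\{(x_t,x_n)\in\mathbb R^2\times\mathbb R:\|x_t\|\le\mu_i x_n\}$. $\mathbf y(\mathbf v)=-\mathbf R^{-1}(\mathbf J\mathbf v-\hat{\mathbf v}_c)$, and $P_{\mathcal F}(\mathbf y)=\arg\min_{\gamma\in\mathcal F}\tfrac12(\gamma-\mathbf y)^T\mathbf R(\gamma-\mathbf y)$. The function $\ell_p$ is strongly convex and continuously differentiable, so $\mathbf v_*$ exists and is unique. SAP iteration. Starting from $\mathbf v_0$, for $m=0,1,2,\dots$ (without a stopping tolerance; if $\nabla\ell_p(\mathbf v_m)=0$ the iterate stays at $\mathbf v_m$): $$\mathbf d_m=-\mathbf H(\mathbf v_m)^{-1}\nabla\ell_p(\mathbf v_m),\quad t_m=\arg\min_{t>0}\ell_p(\mathbf v_m+t\mathbf d_m),\quad \mathbf v_{m+1}=\mathbf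 v_m+t_m\mathbf d_m,$$ where $\mathbf H(\mathbf v)=\mathbf A+\mathbf J^T\mathbf G(\mathbf v)\mathbf J$ and $\mathbf G(\mathbf v)=\mathrm{diag}(G_1,\dots,G_{n_c})$ is block diagonal with $G_i=R_i^{-1}S_i(y_i)R_i^{-1}\in\mathbb R^{3\times3}$, $y_i\in\mathbb R^3$ being the $i$-th block of $\mathbf y(\mathbf v)$. Dropping $i$ and writing $y=(y_t,y_n)\in\mathbb R^2\times\mathbb R$, $y_r=\|y_t\|$, $\hat t=y_t/y_r$, $\tilde\mu=\mu(R_t/R_n)^{1/2}$, $\hat\mu=\mu R_t/R_n$, $P=\hat t\hat t^T$, $P^\perp=I_2-P$, $\hat s=\hat\mu y_r+y_n$, the matrix $S(y)$ is: - $S(y)=R=\mathrm{diag}(R_t,R_t,R_n)$ if $y_r\le\mu y_n$; - $S(y)=0$ if $y_n<-\hat\mu y_r$; - otherwise (so $y_r>0$), $S(y)=\dfrac{R_n}{1+\tilde\mu^2}\begin{bmatrix}\hat\mu\left(\hat\mu P+\hat s P^\perp/y_r\right)&\hat\mu\hat t\\ \hat\mu\hat t^T&1\end{bmatrix}$. $\mathbf H(\mathbf v)$ is symmetric positive definite for all $\mathbf v$. The norm $\|\cdot\|$ without subscript is Euclidean. *)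

theory Defs
  imports "HOL-Analysis.Analysis"
begin

text \<open>
  There are \<open>CARD('c)\<close> contacts and \<open>CARD('n)\<close> generalized velocities.  A stacked contact
  vector in dimension \<open>3 * CARD('c)\<close> is indexed by pairs (contact, component); within each block,
  components 1 and 2 are tangential and component 3 is normal.
\<close>

definition contact_block :: "real ^ ('c \<times> 3) \<Rightarrow> 'c::finite \<Rightarrow> real ^ 3" where
  "contact_block x i = (\<chi> k. x $ (i, k))"

definition block_diag :: "('c \<Rightarrow> real ^ 3 ^ 3) \<Rightarrow> real ^ ('c::finite \<times> 3) ^ ('c \<times> 3)" where
  "block_diag B = (\<chi> p q. if fst p = fst q then B (fst p) $ snd p $ snd q else 0)"

definition tangential :: "real ^ 3 \<Rightarrow> real ^ 2" where
  "tangential x = vector [x $ 1, x $ 2]"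

text \<open>The symmetric 3-by-3 matrix with tangential block \<open>M\<close>, off-diagonal blocks \<open>b\<close> and
  its transpose, and normal entry \<open>c\<close>.\<close>

definition tn_matrix :: "real ^ 2 ^ 2 \<Rightarrow> real ^ 2 \<Rightarrow> real \<Rightarrow> real ^ 3 ^ 3" where
  "tn_matrix M b c = vector
     [vector [M $ 1 $ 1, M $ 1 $ 2, b $ 1],
      vector [M $ 2 $ 1, M $ 2 $ 2, b $ 2],
      vector [b $ 1,     b $ 2,     c]]"

definition sym_pos_def :: "real ^ 'n ^ 'n \<Rightarrow> bool" where
  "sym_pos_def X \<longleftrightarrow> transpose X = X \<and> (\<forall>z. z \<noteq> 0 \<longrightarrow> 0 < z \<bullet> (X *v z))"

definition sqnorm_wrt :: "real ^ 'n ^ 'n \<Rightarrow> real ^ 'n \<Rightarrow> real" where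
  "sqnorm_wrt X z = z \<bullet> (X *v z)"

definition gradient :: "('a::real_inner \<Rightarrow> real) \<Rightarrow> 'a \<Rightarrow> 'a" where
  "gradient f x = (THE g. GDERIV f x :> g)"

definition R_block :: "real \<Rightarrow> real \<Rightarrow> real ^ 3 ^ 3" where
  "R_block Rt Rn = vector [vector [Rt, 0, 0], vector [0, Rt, 0], vector [0, 0, Rn]]"

definition R_matrix :: "('c \<Rightarrow> real) \<Rightarrow> ('c \<Rightarrow> real) \<Rightarrow> real ^ ('c::finite \<times> 3) ^ ('c \<times> 3)" where
  "R_matrix Rt Rn = block_diag (\<lambda>i. R_block (Rt i) (Rn i))"

definition friction_cone :: "real \<Rightarrow> (real ^ 3) set" where
  "friction_cone \<mu> = {x. norm (tangential x) \<le> \<mu> * x $ 3}"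

definition friction_cones :: "('c \<Rightarrow> real) \<Rightarrow> (real ^ ('c::finite \<times> 3)) set" where
  "friction_cones \<mu> = {\<gamma>. \<forall>i. contact_block \<gamma> i \<in> friction_cone (\<mu> i)}"

definition cone_proj ::
  "('c \<Rightarrow> real) \<Rightarrow> ('c \<Rightarrow> real) \<Rightarrow> ('c \<Rightarrow> real) \<Rightarrow> real ^ ('c::finite \<times> 3) \<Rightarrow> real ^ ('c \<times> 3)" where
  "cone_proj \<mu> Rt Rn y =
     arg_min_on (\<lambda>\<gamma>. 1/2 * ((\<gamma> - y) \<bullet> (R_matrix Rt Rn *v (\<gamma> - y)))) (friction_cones \<mu>)"

definition y_of ::
  "real ^ 'n ^ ('c \<times> 3) \<Rightarrow> real ^ ('c \<times> 3) \<Rightarrow> ('c \<Rightarrow> real) \<Rightarrow> ('c \<Rightarrow> real) \<Rightarrow>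
   real ^ 'n \<Rightarrow> real ^ ('c::finite \<times> 3)" where
  "y_of J vc_hat Rt Rn v = - (matrix_inv (R_matrix Rt Rn) *v (J *v v - vc_hat))"

text \<open>\<open>v_free\<close> is the velocity usually written \<open>v*\<close>; it is data, not the minimizer.\<close>

definition primal_cost ::
  "real ^ 'n ^ 'n \<Rightarrow> real ^ 'n ^ ('c \<times> 3) \<Rightarrow> real ^ 'n \<Rightarrow> real ^ ('c \<times> 3) \<Rightarrow>
   ('c \<Rightarrow> real) \<Rightarrow> ('c \<Rightarrow> real) \<Rightarrow> ('c::finite \<Rightarrow> real) \<Rightarrow> real ^ 'n \<Rightarrow> real" where
  "primal_cost A J v_free vc_hat \<mu> Rt Rn v =
     1/2 * sqnorm_wrt A (v - v_free)
     + 1/2 * sqnorm_wrt (R_matrix Rt Rn) (cone_proj \<mu> Rt Rn (y_of J vc_hat Rt Rn v))"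

text \<open>\<open>R_block Rt Rn\<close> times the Jacobian of the cone projection at \<open>y\<close>, with a fixed choice on the
  boundaries where the projection is not differentiable.  The last branch is only reached with
  \<open>yr > 0\<close> when \<open>\<mu>\<close>, \<open>Rt\<close> and \<open>Rn\<close> are positive, so its divisions are harmless.\<close>

definition S_block :: "real \<Rightarrow> real \<Rightarrow> real \<Rightarrow> real ^ 3 \<Rightarrow> real ^ 3 ^ 3" where
  "S_block \<mu> Rt Rn y =
     (let yt = tangential y; yn = y $ 3; yr = norm yt; t = (1 / yr) *\<^sub>R yt;
          \<mu>t = \<mu> * sqrt (Rt / Rn); \<mu>h = \<mu> * Rt / Rn;
          P = (\<chi> j k. t $ j * t $ k); Pp = mat 1 - P; s = \<mu>h * yr + yn
      in if yr \<le> \<mu> * yn then R_block Rt Rn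
         else if yn < - \<mu>h * yr then 0
         else (Rn / (1 + \<mu>t\<^sup>2)) *\<^sub>R
                tn_matrix (\<mu>h *\<^sub>R (\<mu>h *\<^sub>R P + (s / yr) *\<^sub>R Pp)) (\<mu>h *\<^sub>R t) 1)"

definition G_matrix ::
  "real ^ 'n ^ ('c \<times> 3) \<Rightarrow> real ^ ('c \<times> 3) \<Rightarrow>
   ('c \<Rightarrow> real) \<Rightarrow> ('c \<Rightarrow> real) \<Rightarrow> ('c::finite \<Rightarrow> real) \<Rightarrow> real ^ 'n \<Rightarrow> real ^ ('c \<times> 3) ^ ('c \<times> 3)" where
  "G_matrix J vc_hat \<mu> Rt Rn v =
     block_diag (\<lambda>i. matrix_inv (R_block (Rt i) (Rn i))
       ** S_block (\<mu> i) (Rt i) (Rn i) (contact_block (y_of J vc_hat Rt Rn v) i)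
       ** matrix_inv (R_block (Rt i) (Rn i)))"

definition H_matrix ::
  "real ^ 'n ^ 'n \<Rightarrow> real ^ 'n ^ ('c \<times> 3) \<Rightarrow> real ^ ('c \<times> 3) \<Rightarrow>
   ('c \<Rightarrow> real) \<Rightarrow> ('c \<Rightarrow> real) \<Rightarrow> ('c::finite \<Rightarrow> real) \<Rightarrow> real ^ 'n \<Rightarrow> real ^ 'n ^ 'n" where
  "H_matrix A J vc_hat \<mu> Rt Rn v = A + transpose J ** G_matrix J vc_hat \<mu> Rt Rn v ** J"

text \<open>One iteration: an exact line search along the Newton-type direction; the iterate is left
  unchanged where the gradient vanishes, since there the line search over \<open>t > 0\<close> does not
  determine \<open>t\<close>.\<close>

definition sap_step ::
  "real ^ 'n ^ 'n \<Rightarrow> real ^ 'n ^ ('c \<times> 3) \<Rightarrow> real ^ 'n \<Rightarrow> real ^ ('c \<times> 3) \<Rightarrow>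
   ('c \<Rightarrow> real) \<Rightarrow> ('c \<Rightarrow> real) \<Rightarrow> ('c::finite \<Rightarrow> real) \<Rightarrow> real ^ 'n \<Rightarrow> real ^ 'n" where
  "sap_step A J v_free vc_hat \<mu> Rt Rn v =
     (let \<ll> = primal_cost A J v_free vc_hat \<mu> Rt Rn;
          d = - (matrix_inv (H_matrix A J vc_hat \<mu> Rt Rn v) *v gradient \<ll> v);
          t = arg_min (\<lambda>t::real. \<ll> (v + t *\<^sub>R d)) (\<lambda>t. 0 < t)
      in if gradient \<ll> v = 0 then v else v + t *\<^sub>R d)"

primrec sap_iter ::
  "real ^ 'n ^ 'n \<Rightarrow> real ^ 'n ^ ('c \<times> 3) \<Rightarrow> real ^ 'n \<Rightarrow> real ^ ('c \<times> 3) \<Rightarrow>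
   ('c \<Rightarrow> real) \<Rightarrow> ('c \<Rightarrow> real) \<Rightarrow> ('c::finite \<Rightarrow> real) \<Rightarrow> real ^ 'n \<Rightarrow> nat \<Rightarrow> real ^ 'n" where
  "sap_iter A J v_free vc_hat \<mu> Rt Rn v0 0 = v0"
| "sap_iter A J v_free vc_hat \<mu> Rt Rn v0 (Suc m) =
     sap_step A J v_free vc_hat \<mu> Rt Rn (sap_iter A J v_free vc_hat \<mu> Rt Rn v0 m)"

end

theory Submission
  imports Defs
begin

text \<open>
  By Moreau's decomposition with respect to the cone \<open>\<F>\<close>, the projection term of the cost lies between
  its linearization and that linearization plus a quadratic.  Hence the cost is strongly convex with gradient
  \<open>A (v - v*) - J\<^sup>T P(y(v))\<close> and quadratic upper bounds.  As \<open>H\<close> is uniformly positive definite and bounded,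
  the exact line search decreases the cost by at least a multiple of the squared norm of the gradient,
  which forces convergence.

  For the rate, \<open>S(y)\<close> is \<open>R\<close> times an element of the generalized Jacobian of the projection, and the
  projection is strongly semismooth: its linearization at \<open>y\<close> with matrix \<open>S(y)\<close> predicts the value at a
  fixed \<open>y0\<close> up to \<open>O(\<bar>y - y0\<bar>\<^sup>2)\<close>.  So the full step \<open>v + d\<close> has quadratically small error, also at
  kinks of the projection.  The exact line search achieves a cost no larger than that of the full step,
  and strong convexity turns the cost gap back into a distance.
\<close>

section \<open>Exact line search for strongly convex functions\<close>

lemma gradient_eqI:
  assumes "GDERIV f x :> g"
  shows "gradient f x = g"
  unfolding gradient_def
proof (rule the_equality[where P = "\<lambda>g. GDERIV f x :> g", OF assms])
  fix g' assume "GDERIV f x :> g'"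
  then have "(\<lambda>h. h \<bullet> g') = (\<lambda>h. h \<bullet> g)"
    using assms has_derivative_unique unfolding gderiv_def by blast
  then have "(g' - g) \<bullet> g' = (g' - g) \<bullet> g" by (rule fun_cong)
  then have "(g' - g) \<bullet> (g' - g) = 0" by (simp add: inner_diff_right)
  then show "g' = g" by simp
qed

text \<open>The two quadratic bounds squeeze the remainder of the linear model, so they already make
  \<open>g\<close> the gradient of \<open>f\<close> (\<open>gderiv_f\<close>) and \<open>f\<close>
  continuous.\<close>

locale strongly_convex_smooth =
  fixes f :: "'a::euclidean_space \<Rightarrow> real" and g :: "'a \<Rightarrow> 'a" and \<sigma> L :: real
  assumes \<sigma>_pos: "0 < \<sigma>" and L_pos: "0 < L"
    and lower: "f v + g v \<bullet> (w - v) + \<sigma> / 2 * (norm (w - v))\<^sup>2 \<le> f w"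
    and upper: "f w \<le> f v + g v \<bullet> (w - v) + L / 2 * (norm (w - v))\<^sup>2"
begin

lemma gderiv_f: "GDERIV f v :> g v"
  unfolding gderiv_def
proof (rule has_derivativeI_sandwich[where e = 1 and H = "\<lambda>w. L / 2 * norm (w - v)"])
  show "bounded_linear (\<lambda>h. h \<bullet> g v)" by (rule bounded_linear_inner_left)
  show "((\<lambda>w. L / 2 * norm (w - v)) \<longlongrightarrow> 0) (at v)"
    by (auto intro!: tendsto_eq_intros)
  fix w assume "w \<noteq> v"
  then have n: "norm (w - v) > 0" by simp
  have "0 \<le> f w - f v - (w - v) \<bullet> g v"
    using lower[of v w] \<sigma>_pos by (simp add: inner_commute) (smt (verit) divide_nonneg_pos mult_nonneg_nonneg zero_le_power2)
  moreover have "f w - f v - (w - v) \<bullet> g v \<le> L / 2 * norm (w - v) * norm (w - v)"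
    using upper[of w v] by (simp add: inner_commute power2_eq_square)
  ultimately show "norm (f w - f v - (w - v) \<bullet> g v) / norm (w - v) \<le> L / 2 * norm (w - v)"
    using n by (simp add: divide_simps)
qed simp

lemma gradient_f: "gradient f = g"
  by (rule ext) (rule gradient_eqI[OF gderiv_f])

lemma continuous_f: "continuous_on S f"
  using gderiv_f unfolding gderiv_def
  by (meson continuous_at_imp_continuous_on has_derivative_continuous)

text \<open>The step length is the minimizer of the upper quadratic model along \<open>d\<close>.\<close>

lemma model_decrease:
  assumes "d \<noteq> 0"
  shows "f (v + (- (g v \<bullet> d) / (L * (norm d)\<^sup>2)) *\<^sub>R d) \<le> f v - (g v \<bullet> d)\<^sup>2 / (2 * L * (norm d)\<^sup>2)"
proof -
  define q n s where "q = g v \<bullet> d" and "n = (norm d)\<^sup>2" and "s = - q / (L * n)"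
  have n: "n > 0" using assms by (simp add: n_def)
  have "f (v + s *\<^sub>R d) \<le> f v + s * q + L / 2 * (s\<^sup>2 * n)"
    using upper[of "v + s *\<^sub>R d" v] by (simp add: power_mult_distrib q_def n_def)
  also have "\<dots> = f v - q\<^sup>2 / (2 * L * n)"
    using n L_pos by (simp add: s_def field_simps power2_eq_square)
  finally show ?thesis by (simp add: q_def n_def s_def)
qed

text \<open>Along a unit vector the lower bound exceeds \<open>f v\<close> by at least
  \<open>s * (\<sigma> * s / 2 - \<bar>g v \<bullet> u\<bar>)\<close>. Minimization over the whole
  space or along a ray thereby reduces to a compact set.\<close>

lemma far_no_decrease:
  assumes "2 * \<bar>g v \<bullet> u\<bar> \<le> \<sigma> * s" "norm u = 1" "0 \<le> s"
  shows "f v \<le> f (v + s *\<^sub>R u)"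
proof -
  have "s * (\<sigma> * s - 2 * \<bar>g v \<bullet> u\<bar>) \<ge> 0" using assms by simp
  moreover have "s * (g v \<bullet> u) \<ge> - s * \<bar>g v \<bullet> u\<bar>"
    using assms(3) by (metis abs_ge_minus_self abs_minus_commute minus_le_iff mult_left_mono mult_minus_left mult_minus_right)
  ultimately show ?thesis
    using lower[of v "v + s *\<^sub>R u"] assms by (simp add: power2_eq_square algebra_simps)
qed

lemma minimizer_exists: "\<exists>x. \<forall>y. f x \<le> f y"
proof -
  \<comment> \<open>No slope of \<open>f\<close> at 0 exceeds \<open>norm (g 0)\<close>, so beyond
    this radius \<open>far_no_decrease\<close> applies from 0 in every direction.\<close>
  define T where "T = 2 * norm (g 0) / \<sigma>"
  have "T \<ge> 0" unfolding T_def using \<sigma>_pos by simp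
  then obtain x where x: "x \<in> cball 0 T" "\<And>y. y \<in> cball 0 T \<Longrightarrow> f x \<le> f y"
    using continuous_attains_inf[OF compact_cball _ continuous_f, of "0::'a" T] by auto
  have "f x \<le> f y" for y
  proof (cases "y \<in> cball 0 T")
    case False
    then have y: "norm y > T" "y \<noteq> 0" using \<open>T \<ge> 0\<close> by auto
    have "2 * \<bar>g 0 \<bullet> (y /\<^sub>R norm y)\<bar> \<le> 2 * norm (g 0)"
      using Cauchy_Schwarz_ineq2[of "g 0" "y /\<^sub>R norm y"] y by simp
    also have "\<dots> \<le> \<sigma> * norm y" using y \<sigma>_pos by (simp add: T_def field_simps)
    finally have "f 0 \<le> f (0 + norm y *\<^sub>R (y /\<^sub>R norm y))"
      using y by (intro far_no_decrease) auto
    moreover have "f x \<le> f 0" using x(2)[of 0] \<open>T \<ge> 0\<close> by simp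
    ultimately show ?thesis using y by simp
  qed (rule x(2))
  then show ?thesis by blast
qed

text \<open>The same \<open>arg_min\<close> term as \<open>v_min\<close> in the theorem. It is a
  choice, and \<open>minimizer_exists\<close> guarantees that a minimizer is picked.\<close>

definition minimizer :: 'a where "minimizer = arg_min f (\<lambda>_. True)"

lemma minimizer_le: "f minimizer \<le> f y"
proof -
  obtain x where "\<forall>y. f x \<le> f y" using minimizer_exists by blast
  then show ?thesis unfolding minimizer_def
    by (intro arg_minI[where x = x and Q = "\<lambda>x. f x \<le> f y"]) (auto simp: not_less)
qed

text \<open>Otherwise \<open>model_decrease\<close> with \<open>d = g minimizer\<close> would give a
  value strictly below the minimum.\<close>

lemma gradient_minimizer: "g minimizer = 0"
proof (rule ccontr)
  assume n: "g minimizer \<noteq> 0"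
  then have "(g minimizer \<bullet> g minimizer)\<^sup>2 / (2 * L * (norm (g minimizer))\<^sup>2) > 0"
    using L_pos by simp
  with model_decrease[OF n] minimizer_le show False
    by (smt (verit, ccfv_SIG))
qed

lemma gap_lower: "\<sigma> / 2 * (norm (v - minimizer))\<^sup>2 \<le> f v - f minimizer"
  using lower[of minimizer v] gradient_minimizer by simp

lemma gap_upper: "f v - f minimizer \<le> L / 2 * (norm (v - minimizer))\<^sup>2"
  using upper[of v minimizer] gradient_minimizer by simp

text \<open>Follows from the lower bound at \<open>v\<close>, evaluated at the minimizer, together
  with \<open>f minimizer \<le> f v\<close> and Cauchy-Schwarz. It turns vanishing gradients into
  convergence of the iterates.\<close>

lemma error_le_gradient: "norm (v - minimizer) \<le> 2 / \<sigma> * norm (g v)"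
proof -
  have "\<sigma> / 2 * (norm (v - minimizer))\<^sup>2 \<le> g v \<bullet> (v - minimizer)"
    using lower[of v minimizer] minimizer_le[of v]
    by (simp add: norm_minus_commute inner_diff_right)
  also have "\<dots> \<le> norm (g v) * norm (v - minimizer)" by (rule norm_cauchy_schwarz)
  finally have "norm (v - minimizer) * (\<sigma> / 2 * norm (v - minimizer)) \<le> norm (v - minimizer) * norm (g v)"
    by (simp add: power2_eq_square mult_ac)
  then have "\<sigma> / 2 * norm (v - minimizer) \<le> norm (g v)"
    by (cases "norm (v - minimizer) = 0") (auto simp: mult_le_cancel_left)
  then show ?thesis using \<sigma>_pos by (simp add: field_simps)
qed

text \<open>A minimum over the open half-line must be shown to be attained before
  \<open>arg_min\<close> says anything. It is attained on a compact interval \<open>{0..T}\<close>,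
  and a descent direction excludes the endpoint 0.\<close>

lemma line_search:
  assumes "g v \<bullet> d < 0" "0 < s"
  shows "f (v + arg_min (\<lambda>t::real. f (v + t *\<^sub>R d)) (\<lambda>t. 0 < t) *\<^sub>R d) \<le> f (v + s *\<^sub>R d)"
proof -
  have d: "d \<noteq> 0" using assms by auto
  \<comment> \<open>The threshold of \<open>far_no_decrease\<close>, rescaled from the unit vector
    to \<open>d\<close>: beyond it the values are at least \<open>f v\<close>.\<close>
  define T where "T = 2 * \<bar>g v \<bullet> d\<bar> / (\<sigma> * (norm d)\<^sup>2)"
  have T: "T > 0" unfolding T_def using assms d \<sigma>_pos by (intro divide_pos_pos) auto
  have "continuous_on {0..T} (\<lambda>t. f (v + t *\<^sub>R d))"
    by (rule continuous_on_compose2[OF continuous_f[of UNIV]]) (auto intro!: continuous_intros)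
  then obtain t where t: "t \<in> {0..T}" "\<And>s. s \<in> {0..T} \<Longrightarrow> f (v + t *\<^sub>R d) \<le> f (v + s *\<^sub>R d)"
    using continuous_attains_inf[of "{0..T}" "\<lambda>t. f (v + t *\<^sub>R d)"] T by auto
  have min: "f (v + t *\<^sub>R d) \<le> f (v + s *\<^sub>R d)" if "s > 0" for s
  proof (cases "s \<le> T")
    case False
    have "2 * \<bar>g v \<bullet> (d /\<^sub>R norm d)\<bar> \<le> \<sigma> * (s * norm d)"
      using False d \<sigma>_pos by (simp add: T_def abs_mult field_simps power2_eq_square)
    then have "f v \<le> f (v + (s * norm d) *\<^sub>R (d /\<^sub>R norm d))"
      using d that by (intro far_no_decrease) auto
    moreover have "(s * norm d) *\<^sub>R (d /\<^sub>R norm d) = s *\<^sub>R d" using d by simp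
    ultimately have "f v \<le> f (v + s *\<^sub>R d)" by (simp only:)
    then show ?thesis using t(2)[of 0] T by simp
  qed (use that t in auto)
  \<comment> \<open>The step length of \<open>model_decrease\<close> is positive here and strictly
    lowers \<open>f\<close>.\<close>
  have "t \<noteq> 0"
  proof
    assume "t = 0"
    have "- (g v \<bullet> d) / (L * (norm d)\<^sup>2) > 0" using assms d L_pos by (intro divide_pos_pos) auto
    from min[OF this] \<open>t = 0\<close> model_decrease[OF d, of v]
    have "(g v \<bullet> d)\<^sup>2 / (2 * L * (norm d)\<^sup>2) \<le> 0" by simp
    moreover have "(g v \<bullet> d)\<^sup>2 / (2 * L * (norm d)\<^sup>2) > 0" using assms d L_pos by simp
    ultimately show False by simp
  qed
  then have "t > 0" using t by simp
  then show ?thesis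
    using assms(2) min
    by (intro arg_minI[where x = t and Q = "\<lambda>t. f (v + t *\<^sub>R d) \<le> f (v + s *\<^sub>R d)"])
      (auto simp: not_less)
qed

end

section \<open>Matrix inverses and coercive matrices\<close>

lemma matrix_inv_right:
  fixes M :: "'a::field ^ 'n ^ 'n"
  assumes "invertible M"
  shows "M ** matrix_inv M = mat 1"
  using someI_ex[OF assms[unfolded invertible_def]] unfolding matrix_inv_def by blast

lemma matrix_inv_eqI:
  fixes M :: "'a::field ^ 'n ^ 'n"
  assumes "N ** M = mat 1"
  shows "matrix_inv M = N"
proof -
  have "invertible M" using assms by (auto simp: invertible_left_inverse)
  then have "N ** (M ** matrix_inv M) = N" by (simp add: matrix_inv_right)
  then show ?thesis by (simp add: matrix_mul_assoc assms)
qed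

lemma coercive_matrix_inv:
  fixes M :: "real ^ 'n ^ 'n"
  assumes "0 < \<sigma>" "\<And>z. \<sigma> * (norm z)\<^sup>2 \<le> z \<bullet> (M *v z)"
  shows "M *v (matrix_inv M *v x) = x"
proof -
  have "M *v z = 0 \<Longrightarrow> z = 0" for z
    using assms(2)[of z] assms(1) by (simp add: mult_le_0_iff)
  then have "invertible M"
    by (simp add: invertible_left_inverse matrix_left_invertible_ker)
  then show ?thesis
    by (simp add: matrix_vector_mul_assoc matrix_inv_right)
qed

lemma coercive_norm_le:
  fixes M :: "real ^ 'n ^ 'n"
  assumes "\<And>z. \<sigma> * (norm z)\<^sup>2 \<le> z \<bullet> (M *v z)"
  shows "\<sigma> * norm z \<le> norm (M *v z)"
proof (cases "z = 0")
  case False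
  have "\<sigma> * (norm z)\<^sup>2 \<le> norm z * norm (M *v z)"
    using assms[of z] norm_cauchy_schwarz order_trans by blast
  with False show ?thesis by (simp add: power2_eq_square)
qed simp

section \<open>Newton-type directions with exact line search\<close>

locale newton_line_search = strongly_convex_smooth f g \<sigma> L
  for f :: "real ^ 'n \<Rightarrow> real" and g \<sigma> L +
  fixes H :: "real ^ 'n \<Rightarrow> real ^ 'n ^ 'n" and K :: real
  assumes K_pos: "0 < K"
    and H_lower: "\<sigma> * (norm z)\<^sup>2 \<le> z \<bullet> (H v *v z)"
    and H_upper: "norm (H v *v z) \<le> K * norm z"
begin

definition direction :: "real ^ 'n \<Rightarrow> real ^ 'n" where
  "direction v = - (matrix_inv (H v) *v g v)"

definition step :: "real ^ 'n \<Rightarrow> real ^ 'n" where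
  "step v = (if g v = 0 then v else
     v + arg_min (\<lambda>t::real. f (v + t *\<^sub>R direction v)) (\<lambda>t. 0 < t) *\<^sub>R direction v)"

lemma H_direction: "H v *v direction v = - g v"
  using coercive_matrix_inv[OF \<sigma>_pos H_lower] by (simp add: direction_def linear_neg[OF matrix_vector_mul_linear])

lemma descent: "g v \<bullet> direction v \<le> - \<sigma> * (norm (direction v))\<^sup>2"
  using H_lower[of "direction v" v] by (simp add: H_direction inner_commute)

lemma norm_gradient_le: "norm (g v) \<le> K * norm (direction v)"
  using H_upper[of v "direction v"] by (simp add: H_direction)

lemma step_le:
  assumes "0 < s"
  shows "f (step v) \<le> f (v + s *\<^sub>R direction v) \<or> g v = 0"
proof (cases "g v = 0")
  case False
  then have "direction v \<noteq> 0" using norm_gradient_le[of v] by auto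
  then have "g v \<bullet> direction v < 0"
    using descent[of v] \<sigma>_pos by (smt (verit) mult_minus_left mult_pos_pos zero_less_norm_iff zero_less_power)
  then show ?thesis using line_search[OF _ assms] False by (simp add: step_def)
qed simp

text \<open>The line search does at least as well as the step of \<open>model_decrease\<close>.
  Coercivity of \<open>H\<close> bounds \<open>- (g v \<bullet> d)\<close> below by
  \<open>\<sigma> * (norm d)^2\<close>, and its boundedness bounds \<open>norm d\<close> below by
  \<open>norm (g v) / K\<close>.\<close>

lemma step_decrease: "\<sigma>\<^sup>2 / (2 * L * K\<^sup>2) * (norm (g v))\<^sup>2 \<le> f v - f (step v)"
proof (cases "g v = 0")
  case True
  then show ?thesis by (simp add: step_def)
next
  case False
  define d where "d = direction v"
  have d: "d \<noteq> 0" using norm_gradient_le[of v] False by (auto simp: d_def)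
  have desc: "\<sigma> * (norm d)\<^sup>2 \<le> - (g v \<bullet> d)" using descent[of v] by (simp add: d_def)
  moreover have "0 < \<sigma> * (norm d)\<^sup>2" using d \<sigma>_pos by simp
  ultimately have gd: "- (g v \<bullet> d) > 0" by linarith
  have "(norm (g v))\<^sup>2 \<le> (K * norm d)\<^sup>2"
    using norm_gradient_le[of v] by (intro power_mono) (auto simp: d_def)
  then have "\<sigma>\<^sup>2 / (2 * L * K\<^sup>2) * (norm (g v))\<^sup>2 \<le> \<sigma>\<^sup>2 / (2 * L * K\<^sup>2) * (K * norm d)\<^sup>2"
    using L_pos by (intro mult_left_mono) auto
  also have "\<dots> = (\<sigma> * (norm d)\<^sup>2)\<^sup>2 / (2 * L * (norm d)\<^sup>2)"
    using d K_pos L_pos by (simp add: field_simps power2_eq_square)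
  also have "\<dots> \<le> (- (g v \<bullet> d))\<^sup>2 / (2 * L * (norm d)\<^sup>2)"
    using desc L_pos \<sigma>_pos by (intro divide_right_mono power_mono) auto
  also have "\<dots> \<le> f v - f (v + (- (g v \<bullet> d) / (L * (norm d)\<^sup>2)) *\<^sub>R d)"
    using model_decrease[OF d, of v] by simp
  also have "\<dots> \<le> f v - f (step v)"
  proof -
    have "- (g v \<bullet> d) / (L * (norm d)\<^sup>2) > 0" using gd d L_pos by (intro divide_pos_pos) auto
    from step_le[OF this, of v] False show ?thesis unfolding d_def by linarith
  qed
  finally show ?thesis .
qed

text \<open>The values decrease and are bounded below, so their successive differences tend to 0. By
  \<open>step_decrease\<close> the gradients do so too, and \<open>error_le_gradient\<close> carries
  this over to the errors.\<close>

lemma iterates_converge: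
  assumes "\<And>m. x (Suc m) = step (x m)"
  shows "x \<longlonglongrightarrow> minimizer"
proof -
  define c where "c = \<sigma>\<^sup>2 / (2 * L * K\<^sup>2)"
  have c: "c > 0" using \<sigma>_pos L_pos K_pos by (simp add: c_def)
  have dec: "c * (norm (g (x m)))\<^sup>2 \<le> f (x m) - f (x (Suc m))" for m
    using step_decrease[of "x m"] by (simp add: assms c_def)
  have "decseq (\<lambda>m. f (x m))"
  proof (rule decseq_SucI)
    fix m
    have "0 \<le> c * (norm (g (x m)))\<^sup>2" using c by simp
    with dec[of m] show "f (x (Suc m)) \<le> f (x m)" by linarith
  qed
  then obtain l where l: "(\<lambda>m. f (x m)) \<longlonglongrightarrow> l"
    using decseq_convergent[of "\<lambda>m. f (x m)" "f minimizer"] minimizer_le by blast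
  have "(\<lambda>m. (f (x m) - f (x (Suc m))) / c) \<longlonglongrightarrow> (l - l) / c"
    using c by (intro tendsto_intros l LIMSEQ_Suc) auto
  then have lim: "(\<lambda>m. (f (x m) - f (x (Suc m))) / c) \<longlonglongrightarrow> 0" by simp
  have "(\<lambda>m. (norm (g (x m)))\<^sup>2) \<longlonglongrightarrow> 0"
  proof (rule tendsto_sandwich[OF _ _ tendsto_const lim])
    have "(norm (g (x m)))\<^sup>2 \<le> (f (x m) - f (x (Suc m))) / c" for m
      using dec[of m] c by (simp add: pos_le_divide_eq mult.commute)
    then show "\<forall>\<^sub>F m in sequentially. (norm (g (x m)))\<^sup>2 \<le> (f (x m) - f (x (Suc m))) / c" by simp
  qed auto
  then have "(\<lambda>m. sqrt ((norm (g (x m)))\<^sup>2)) \<longlonglongrightarrow> sqrt 0" by (intro tendsto_intros)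
  then have "(\<lambda>m. 2 / \<sigma> * norm (g (x m))) \<longlonglongrightarrow> 2 / \<sigma> * 0"
    by (intro tendsto_mult tendsto_const) simp
  then have "(\<lambda>m. x m - minimizer) \<longlonglongrightarrow> 0"
    by (intro Lim_null_comparison[of "\<lambda>m. x m - minimizer" "\<lambda>m. 2 / \<sigma> * norm (g (x m))"])
      (auto intro!: always_eventually error_le_gradient simp del: times_divide_eq_left)
  then show ?thesis by (simp add: LIM_zero_iff)
qed

text \<open>The exact line search does at least as well in \<open>f\<close> as the full step \<open>s = 1\<close>, whose error is
  quadratically small; strong convexity turns this gap back into a distance.\<close>

lemma step_quadratic:
  assumes "norm (g v - H v *v (v - minimizer)) \<le> C * (norm (v - minimizer))\<^sup>2"
  shows "norm (step v - minimizer) \<le> sqrt (L / \<sigma>) * (C / \<sigma>) * (norm (v - minimizer))\<^sup>2"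
proof (cases "g v = 0")
  case True
  then have "v = minimizer" using error_le_gradient[of v] by simp
  with True show ?thesis by (simp add: step_def)
next
  case False
  define w where "w = v + direction v"
  \<comment> \<open>\<open>H v\<close> maps the error of the full step to minus the residual bounded
    in the assumption; coercivity then bounds the error itself.\<close>
  have "H v *v (w - minimizer) = H v *v (v - minimizer) - g v"
    using H_direction[of v] by (simp add: w_def matrix_vector_mult_add_rdistrib add_diff_eq[symmetric]
        diff_add_eq matrix_vector_mult_diff_distrib matrix_vector_right_distrib)
  then have "\<sigma> * norm (w - minimizer) \<le> C * (norm (v - minimizer))\<^sup>2"
    using coercive_norm_le[OF H_lower, of "w - minimizer" v] assms
    by (simp add: norm_minus_commute)
  then have w: "norm (w - minimizer) \<le> C / \<sigma> * (norm (v - minimizer))\<^sup>2"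
    using \<sigma>_pos by (simp add: field_simps)
  have "\<sigma> / 2 * (norm (step v - minimizer))\<^sup>2 \<le> f (step v) - f minimizer" by (rule gap_lower)
  also have "\<dots> \<le> f w - f minimizer" using step_le[of 1 v] False by (simp add: w_def)
  also have "\<dots> \<le> L / 2 * (norm (w - minimizer))\<^sup>2" by (rule gap_upper)
  finally have "(norm (step v - minimizer))\<^sup>2 \<le> L / \<sigma> * (norm (w - minimizer))\<^sup>2"
    using \<sigma>_pos by (simp add: field_simps)
  then have "norm (step v - minimizer) \<le> sqrt (L / \<sigma>) * norm (w - minimizer)"
    by (metis norm_ge_zero real_le_rsqrt real_sqrt_abs abs_of_nonneg real_sqrt_mult)
  also have "\<dots> \<le> sqrt (L / \<sigma>) * (C / \<sigma> * (norm (v - minimizer))\<^sup>2)"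
    using w L_pos \<sigma>_pos by (intro mult_left_mono) auto
  finally show ?thesis by (simp add: mult.assoc)
qed

text \<open>The residual bound is only local; convergence brings all late iterates into the
  neighbourhood where it holds.\<close>

lemma iterates_quadratic:
  assumes "\<And>m. x (Suc m) = step (x m)"
    and "\<forall>\<^sub>F v in nhds minimizer. norm (g v - H v *v (v - minimizer)) \<le> C * (norm (v - minimizer))\<^sup>2"
  shows "\<exists>M. \<exists>\<zeta>>0. \<forall>m>M. norm (x (Suc m) - minimizer) \<le> \<zeta> * (norm (x m - minimizer))\<^sup>2"
proof -
  define \<zeta> where "\<zeta> = sqrt (L / \<sigma>) * (C / \<sigma>)"
  have "\<forall>\<^sub>F m in sequentially. norm (g (x m) - H (x m) *v (x m - minimizer)) \<le> C * (norm (x m - minimizer))\<^sup>2"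
    using eventually_compose_filterlim[OF assms(2) iterates_converge] assms(1) by blast
  then obtain M where "\<And>m. m \<ge> M \<Longrightarrow> norm (x (Suc m) - minimizer) \<le> \<zeta> * (norm (x m - minimizer))\<^sup>2"
    unfolding eventually_sequentially \<zeta>_def assms(1) using step_quadratic by blast
  \<comment> \<open>The maximum with 1 makes the factor positive, as \<open>C\<close> carries no
    sign.\<close>
  then have "norm (x (Suc m) - minimizer) \<le> max 1 \<zeta> * (norm (x m - minimizer))\<^sup>2" if "m > M" for m
    using that by (meson less_imp_le max.cobounded2 mult_right_mono order_trans zero_le_power2)
  then show ?thesis by (intro exI[of _ M] exI[of _ "max 1 \<zeta>"]) auto
qed

end

section \<open>The projection onto a single friction cone\<close>

lemma tangential_component [simp]: "tangential x $ 1 = x $ 1" "tangential x $ 2 = x $ 2"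
  by (simp_all add: tangential_def)

lemma tangential_add: "tangential (x + y) = tangential x + tangential y"
  and tangential_diff: "tangential (x - y) = tangential x - tangential y"
  and tangential_scaleR: "tangential (c *\<^sub>R x) = c *\<^sub>R tangential x"
  and tangential_zero: "tangential 0 = 0"
  by (simp_all add: vec_eq_iff forall_2)

lemma bounded_linear_tangential: "bounded_linear tangential"
proof -
  have "linear tangential" by (rule linearI) (simp_all add: tangential_add tangential_scaleR)
  then show ?thesis by (simp add: linear_conv_bounded_linear)
qed

lemma inner_tn: "x \<bullet> y = tangential x \<bullet> tangential y + x $ 3 * y $ 3"
  by (simp add: inner_vec_def sum_2 sum_3)

lemma vec3_eqI: "tangential x = tangential y \<Longrightarrow> x $ 3 = y $ 3 \<Longrightarrow> x = y"
  by (simp add: vec_eq_iff forall_2 forall_3)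

lemma norm_le_tn: "norm x \<le> norm (tangential x) + \<bar>x $ 3\<bar>"
proof -
  have "(norm x)\<^sup>2 = (norm (tangential x))\<^sup>2 + \<bar>x $ 3\<bar>\<^sup>2"
    unfolding power2_norm_eq_inner by (simp add: inner_tn[of x x] power2_eq_square)
  also have "\<dots> \<le> (norm (tangential x) + \<bar>x $ 3\<bar>)\<^sup>2"
    by (simp add: power2_sum)
  finally show ?thesis by (rule power2_le_imp_le) simp
qed

lemma norm_tangential_le: "norm (tangential x) \<le> norm x"
proof -
  have "(norm (tangential x))\<^sup>2 \<le> (norm x)\<^sup>2"
    unfolding power2_norm_eq_inner by (simp add: inner_tn[of x x])
  then show ?thesis by (rule power2_le_imp_le) simp
qed

definition tn_vec :: "real ^ 2 \<Rightarrow> real \<Rightarrow> real ^ 3" where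
  "tn_vec a b = vector [a $ 1, a $ 2, b]"

lemma tangential_tn_vec [simp]: "tangential (tn_vec a b) = a"
  and tn_vec_3 [simp]: "tn_vec a b $ 3 = b"
  by (simp_all add: tn_vec_def vec_eq_iff forall_2)

lemma R_block_mult: "R_block a b *v x = tn_vec (a *\<^sub>R tangential x) (b * x $ 3)"
  by (simp add: R_block_def tn_vec_def vec_eq_iff forall_3 matrix_vector_mult_def sum_3)

lemma tn_matrix_mult:
  "tn_matrix M b c *v x = tn_vec (M *v tangential x + x $ 3 *\<^sub>R b) (b \<bullet> tangential x + c * x $ 3)"
  by (simp add: tn_matrix_def tn_vec_def vec_eq_iff forall_3 matrix_vector_mult_def sum_3 sum_2
      inner_vec_def algebra_simps)

lemma outer_mult: "(\<chi> j k. t $ j * t $ k) *v x = (t \<bullet> x) *\<^sub>R (t :: real ^ 'm)"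
  by (simp add: vec_eq_iff matrix_vector_mult_def inner_vec_def sum_distrib_left sum_distrib_right mult_ac)

lemma R_block_inverse:
  assumes "Rt \<noteq> 0" "Rn \<noteq> 0"
  shows "matrix_inv (R_block Rt Rn) = R_block (1 / Rt) (1 / Rn)"
  using assms by (intro matrix_inv_eqI)
    (simp add: R_block_def vec_eq_iff forall_3 matrix_matrix_mult_def sum_3 mat_def)

text \<open>With \<open>t\<close> the tangential direction of \<open>y\<close>, this is the
  projection of \<open>y\<close>, in the inner product given by \<open>R\<close>, onto the line
  spanned by \<open>(\<mu> t, 1)\<close>, which contains a boundary ray of the cone;
  \<open>N\<close> is its normal component.\<close>

definition slide_proj :: "real \<Rightarrow> real \<Rightarrow> real \<Rightarrow> real ^ 3 \<Rightarrow> real ^ 3" where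
  "slide_proj \<mu> Rt Rn y =
     (let a = tangential y; N = (\<mu> * Rt / Rn * norm a + y $ 3) / (1 + \<mu>\<^sup>2 * Rt / Rn)
      in tn_vec ((\<mu> * N / norm a) *\<^sub>R a) N)"

text \<open>The guards repeat those of \<open>S_block\<close>, so both functions always take the
  same branch. That this closed form is the projection rests on \<open>proj_in_cone\<close>,
  \<open>proj_orthogonal\<close> and \<open>proj_polar\<close>.\<close>

definition block_proj :: "real \<Rightarrow> real \<Rightarrow> real \<Rightarrow> real ^ 3 \<Rightarrow> real ^ 3" where
  "block_proj \<mu> Rt Rn y =
     (if norm (tangential y) \<le> \<mu> * y $ 3 then y
      else if y $ 3 < - (\<mu> * Rt / Rn) * norm (tangential y) then 0
      else slide_proj \<mu> Rt Rn y)"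

section \<open>Constants and regions of a single contact\<close>

locale contact =
  fixes \<mu> Rt Rn :: real
  assumes \<mu>_pos: "0 < \<mu>" and Rt_pos: "0 < Rt" and Rn_pos: "0 < Rn"
begin

abbreviation "R \<equiv> R_block Rt Rn"
abbreviation "S \<equiv> S_block \<mu> Rt Rn"
abbreviation "proj \<equiv> block_proj \<mu> Rt Rn"

definition \<mu>h :: real where "\<mu>h = \<mu> * Rt / Rn"

text \<open>Equal to \<open>1 / (1 + \<mu>t^2)\<close> in the notation of \<open>S_block\<close>;
  \<open>c * s y\<close> is the normal component of the sliding projection.\<close>

definition c :: real where "c = 1 / (1 + \<mu>\<^sup>2 * Rt / Rn)"

definition s :: "real ^ 3 \<Rightarrow> real" where "s y = \<mu>h * norm (tangential y) + y $ 3"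

lemma c_pos: "0 < c" and mu_c: "c * (1 + \<mu> * \<mu>h) = 1"
proof -
  have "\<mu>\<^sup>2 * Rt / Rn > 0" using \<mu>_pos Rt_pos Rn_pos by simp
  then show "0 < c" "c * (1 + \<mu> * \<mu>h) = 1"
    by (simp_all add: c_def \<mu>h_def power2_eq_square mult_ac)
qed

lemma muh_pos: "0 < \<mu>h" using \<mu>_pos Rt_pos Rn_pos by (simp add: \<mu>h_def)

lemma muh_Rn: "Rn * \<mu>h = Rt * \<mu>" using Rn_pos by (simp add: \<mu>h_def)

lemma slide_proj_eq:
  "slide_proj \<mu> Rt Rn y = tn_vec ((\<mu> * c * s y / norm (tangential y)) *\<^sub>R tangential y) (c * s y)"
  by (simp add: slide_proj_def Let_def s_def c_def \<mu>h_def)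

text \<open>One split serves \<open>proj\<close> and \<open>S\<close> together. While sliding,
  \<open>S y\<close> is described by its action on vectors, separated into the parts along and
  across the tangential direction, which is the form that the later estimates use.\<close>

lemma proj_cases:
  obtains (stick) "norm (tangential y) \<le> \<mu> * y $ 3" "proj y = y" "S y = R"
  | (sep) "y $ 3 < - \<mu>h * norm (tangential y)" "proj y = 0" "S y = 0"
  | (slide) "\<mu> * y $ 3 < norm (tangential y)" "0 \<le> s y" "tangential y \<noteq> 0"
    "proj y = slide_proj \<mu> Rt Rn y"
    "\<And>z. S y *v z = (Rn * c) *\<^sub>R tn_vec
       (\<mu>h *\<^sub>R (\<mu>h *\<^sub>R (sgn (tangential y) \<bullet> tangential z) *\<^sub>R sgn (tangential y)
         + (s y / norm (tangential y)) *\<^sub>R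
             (tangential z - (sgn (tangential y) \<bullet> tangential z) *\<^sub>R sgn (tangential y))
         + z $ 3 *\<^sub>R sgn (tangential y)))
       (\<mu>h * (sgn (tangential y) \<bullet> tangential z) + z $ 3)"
proof -
  consider "norm (tangential y) \<le> \<mu> * y $ 3"
    | "\<not> norm (tangential y) \<le> \<mu> * y $ 3" "y $ 3 < - \<mu>h * norm (tangential y)"
    | "\<not> norm (tangential y) \<le> \<mu> * y $ 3" "\<not> y $ 3 < - \<mu>h * norm (tangential y)" by blast
  then show thesis
  proof cases
    case 1 then show ?thesis by (intro stick) (auto simp: \<mu>h_def block_proj_def S_block_def Let_def)
  next
    case 2 then show ?thesis by (intro sep) (auto simp: \<mu>h_def block_proj_def S_block_def Let_def)
  next
    case 3
    \<comment> \<open>With zero tangential part the two failed guards would contradict each other;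
      hence the divisions by its norm are genuine.\<close>
    have "tangential y \<noteq> 0"
    proof
      assume "tangential y = 0"
      with 3 have "0 \<le> y $ 3" "\<mu> * y $ 3 < 0" by auto
      then show False using \<mu>_pos by (simp add: mult_less_0_iff)
    qed
    have "Rn / (1 + (\<mu> * sqrt (Rt / Rn))\<^sup>2) = Rn * c"
      using Rt_pos Rn_pos by (simp add: c_def power_mult_distrib)
    moreover define t where "t = sgn (tangential y)"
    ultimately have S: "S y = (Rn * c) *\<^sub>R tn_matrix (\<mu>h *\<^sub>R (\<mu>h *\<^sub>R (\<chi> j k. t $ j * t $ k)
        + (s y / norm (tangential y)) *\<^sub>R (mat 1 - (\<chi> j k. t $ j * t $ k)))) (\<mu>h *\<^sub>R t) 1"
      using 3 by (simp add: S_block_def Let_def s_def \<mu>h_def sgn_div_norm inverse_eq_divide)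
    have "S y *v z = (Rn * c) *\<^sub>R tn_vec
       (\<mu>h *\<^sub>R (\<mu>h *\<^sub>R (t \<bullet> tangential z) *\<^sub>R t
         + (s y / norm (tangential y)) *\<^sub>R (tangential z - (t \<bullet> tangential z) *\<^sub>R t) + z $ 3 *\<^sub>R t))
       (\<mu>h * (t \<bullet> tangential z) + z $ 3)" for z
      unfolding S scaleR_matrix_vector_assoc[symmetric] tn_matrix_mult
        matrix_vector_mult_add_rdistrib matrix_vector_mult_diff_rdistrib outer_mult matrix_vector_mul_lid
      by (simp add: scaleR_add_right mult.commute[of "z $ 3"])
    with \<open>tangential y \<noteq> 0\<close> show ?thesis using 3 unfolding t_def
      by (intro slide) (auto simp: block_proj_def s_def \<mu>h_def)
  qed
qed


lemma sgn_inner_self: "sgn (a :: 'v :: real_inner) \<bullet> a = norm a"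
  by (cases "a = 0") (simp_all add: sgn_div_norm power2_norm_eq_inner[symmetric] power2_eq_square)

text \<open>The weak inequality also admits the boundary with sticking. There
  \<open>norm (tangential y) = \<mu> * y $ 3\<close>, so \<open>mu_c\<close> gives
  \<open>c * s y = y $ 3\<close> and the sliding formula returns \<open>y\<close>.
  \<open>S_slide_remainder\<close> needs this for base points on that boundary.\<close>

lemma R_slide_proj:
  assumes "\<mu> * y $ 3 \<le> norm (tangential y)" "0 \<le> s y" "tangential y \<noteq> 0"
  shows "R *v proj y = (Rn * c * s y) *\<^sub>R tn_vec (\<mu>h *\<^sub>R sgn (tangential y)) 1"
proof (cases y rule: proj_cases)
  case stick
  then have r: "norm (tangential y) = \<mu> * y $ 3" using assms by simp
  have "c * s y = (c * (1 + \<mu> * \<mu>h)) * y $ 3" by (simp add: s_def r algebra_simps)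
  then have cs: "c * s y = y $ 3" by (simp only: mu_c mult_1)
  have "Rn * c * s y * \<mu>h = Rt * norm (tangential y)"
    using cs muh_Rn by (simp add: r mult.assoc mult.left_commute)
  moreover have "tangential y = norm (tangential y) *\<^sub>R sgn (tangential y)"
    using assms(3) by (simp add: sgn_div_norm)
  ultimately show ?thesis using cs
    by (intro vec3_eqI) (simp_all add: stick R_block_mult tangential_scaleR mult.assoc, metis scaleR_scaleR)
next
  case sep
  then show ?thesis using assms by (simp add: s_def)
next
  case slide
  have "Rn * c * s y * \<mu>h = Rt * \<mu> * c * s y" unfolding muh_Rn[symmetric] by simp
  then show ?thesis
    by (intro vec3_eqI) (simp_all add: slide(4) slide_proj_eq R_block_mult tangential_scaleR sgn_div_norm
        divide_inverse mult.assoc, auto)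
qed

text \<open>Euler's identity: \<open>proj\<close> is positively homogeneous of degree 1, and
  \<open>S y\<close> is \<open>R\<close> times an element of its generalized Jacobian. While
  sliding, the part of \<open>S y\<close> across the tangential direction annihilates
  \<open>y\<close>.\<close>

lemma S_self: "S y *v y = R *v proj y"
proof (cases y rule: proj_cases)
  case slide
  have z: "tangential y - norm (tangential y) *\<^sub>R sgn (tangential y) = 0"
    using slide(3) by (simp add: sgn_div_norm)
  have "S y *v y = (Rn * c) *\<^sub>R tn_vec
      (\<mu>h *\<^sub>R (\<mu>h *\<^sub>R norm (tangential y) *\<^sub>R sgn (tangential y) + y $ 3 *\<^sub>R sgn (tangential y)))
      (\<mu>h * norm (tangential y) + y $ 3)"
    unfolding slide(5) sgn_inner_self z by simp
  also have "\<dots> = (Rn * c * s y) *\<^sub>R tn_vec (\<mu>h *\<^sub>R sgn (tangential y)) 1"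
    by (intro vec3_eqI) (simp_all add: tangential_scaleR tangential_add s_def algebra_simps)
  also have "\<dots> = R *v proj y"
    using slide(1-3) by (simp add: R_slide_proj)
  finally show ?thesis .
qed simp_all

text \<open>Together with \<open>proj_orthogonal\<close> and \<open>proj_polar\<close>, this is Moreau's
  characterization of the projection onto a convex cone in the inner product given by \<open>R\<close>.\<close>

lemma proj_in_cone: "norm (tangential (proj y)) \<le> \<mu> * proj y $ 3"
proof (cases y rule: proj_cases)
  case slide
  then show ?thesis using \<mu>_pos c_pos by (simp add: slide_proj_eq abs_mult)
qed (simp_all add: tangential_zero)

section \<open>Nonnegativity and boundedness of \<open>S\<close>\<close>

lemma S_nonneg: "0 \<le> z \<bullet> (S y *v z)"
proof (cases y rule: proj_cases)
  case stick
  then show ?thesis using Rt_pos Rn_pos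
    by (simp add: R_block_mult inner_tn[of z "tn_vec _ _"] mult.left_commute)
next
  case slide
  define t \<tau> where "t = sgn (tangential y)" and "\<tau> = t \<bullet> tangential z"
  have "\<tau>\<^sup>2 \<le> (t \<bullet> t) * (tangential z \<bullet> tangential z)"
    unfolding \<tau>_def by (rule Cauchy_Schwarz_ineq)
  also have "t \<bullet> t = 1" using slide by (simp add: t_def norm_sgn dot_square_norm)
  finally have cs: "0 \<le> tangential z \<bullet> tangential z - \<tau>\<^sup>2" by simp
  \<comment> \<open>The form splits into a square and a transverse part; sliding makes the weight of
    the latter nonnegative, and Cauchy-Schwarz its other factor.\<close>
  have "z \<bullet> (S y *v z) = Rn * c * ((\<mu>h * \<tau> + z $ 3)\<^sup>2
      + \<mu>h * (s y / norm (tangential y)) * (tangential z \<bullet> tangential z - \<tau>\<^sup>2))"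
    unfolding slide(5) t_def[symmetric] \<tau>_def[symmetric]
    by (simp add: inner_tn[of z "tn_vec _ _"] inner_add_right inner_diff_right
        inner_commute[of _ t] \<tau>_def[symmetric] power2_eq_square diff_divide_distrib algebra_simps)
  also have "\<dots> \<ge> 0" using cs slide muh_pos c_pos Rn_pos
    by (intro mult_nonneg_nonneg add_nonneg_nonneg) auto
  finally show ?thesis .
qed simp

text \<open>The only coefficient that could blow up near the apex is
  \<open>s y / norm (tangential y)\<close>. Sliding means
  \<open>y $ 3 < norm (tangential y) / \<mu>\<close>, which keeps it below
  \<open>\<mu>h + 1 / \<mu>\<close>.\<close>

lemma S_bounded: "\<exists>K. \<forall>y z. norm (S y *v z) \<le> K * norm z"
proof -
  \<comment> \<open>\<open>Rt + Rn\<close> bounds the sticking case; the last summand collects the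
    tangential and normal bounds of the sliding case.\<close>
  define K where "K = Rt + Rn + Rn * c * (\<mu>h * (\<mu>h + (\<mu>h + 1 / \<mu>) * 2 + 1) + (\<mu>h + 1))"
  have K: "Rt + Rn \<le> K" using muh_pos \<mu>_pos c_pos Rn_pos
    unfolding K_def by (intro add_increasing2 mult_nonneg_nonneg add_nonneg_nonneg order_refl) auto
  have "norm (S y *v z) \<le> K * norm z" for y z
  proof -
    have z: "norm (tangential z) \<le> norm z" "\<bar>z $ 3\<bar> \<le> norm z"
      by (rule norm_tangential_le) (rule component_le_norm_cart)
    show ?thesis
    proof (cases y rule: proj_cases)
      case stick
      have "norm (R *v z) \<le> Rt * norm (tangential z) + Rn * \<bar>z $ 3\<bar>"
        using norm_le_tn[of "R *v z"] Rt_pos Rn_pos by (simp add: R_block_mult abs_mult)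
      also have "\<dots> \<le> Rt * norm z + Rn * norm z"
        using z Rt_pos Rn_pos by (intro add_mono mult_left_mono) auto
      also have "\<dots> \<le> K * norm z"
        using K by (metis distrib_right mult_right_mono norm_ge_zero)
      finally show ?thesis using stick by simp
    next
      case sep
      then show ?thesis using K Rt_pos Rn_pos by simp
    next
      case slide
      define r t \<tau> where "r = norm (tangential y)" and "t = sgn (tangential y)" and "\<tau> = t \<bullet> tangential z"
      have r: "r > 0" using slide by (simp add: r_def)
      have t: "norm t = 1" using slide by (simp add: t_def norm_sgn)
      have \<tau>: "\<bar>\<tau>\<bar> \<le> norm z"
        using Cauchy_Schwarz_ineq2[of t "tangential z"] t z by (simp add: \<tau>_def)
      have q: "0 \<le> s y / r" "s y / r \<le> \<mu>h + 1 / \<mu>"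
        using slide r \<mu>_pos by (simp_all add: s_def r_def field_simps)
      have p: "norm (tangential z - \<tau> *\<^sub>R t) \<le> 2 * norm z"
        using norm_triangle_ineq4[of "tangential z" "\<tau> *\<^sub>R t"] t z \<tau> by simp
      have "norm (\<mu>h *\<^sub>R \<tau> *\<^sub>R t + (s y / r) *\<^sub>R (tangential z - \<tau> *\<^sub>R t) + z $ 3 *\<^sub>R t)
        \<le> norm (\<mu>h *\<^sub>R \<tau> *\<^sub>R t) + norm ((s y / r) *\<^sub>R (tangential z - \<tau> *\<^sub>R t)) + norm (z $ 3 *\<^sub>R t)"
        by (intro norm_triangle_mono norm_triangle_ineq order_refl)
      also have "\<dots> \<le> \<mu>h * norm z + (\<mu>h + 1 / \<mu>) * (2 * norm z) + norm z"
      proof (intro add_mono)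
        show "norm (\<mu>h *\<^sub>R \<tau> *\<^sub>R t) \<le> \<mu>h * norm z"
          using \<tau> muh_pos t by (simp only: norm_scaleR) (intro mult_mono, auto)
        show "norm ((s y / r) *\<^sub>R (tangential z - \<tau> *\<^sub>R t)) \<le> (\<mu>h + 1 / \<mu>) * (2 * norm z)"
          using q p by (simp only: norm_scaleR) (intro mult_mono, auto)
      qed (use t z in simp)
      also have "\<dots> = (\<mu>h + (\<mu>h + 1 / \<mu>) * 2 + 1) * norm z" by (simp add: algebra_simps)
      finally have T: "norm (\<mu>h *\<^sub>R \<tau> *\<^sub>R t + (s y / r) *\<^sub>R (tangential z - \<tau> *\<^sub>R t) + z $ 3 *\<^sub>R t)
        \<le> (\<mu>h + (\<mu>h + 1 / \<mu>) * 2 + 1) * norm z" .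
      have "\<bar>\<mu>h * \<tau> + z $ 3\<bar> \<le> \<mu>h * \<bar>\<tau>\<bar> + \<bar>z $ 3\<bar>"
        using muh_pos by (metis abs_mult abs_of_pos abs_triangle_ineq)
      also have "\<dots> \<le> \<mu>h * norm z + norm z" using \<tau> z muh_pos by (intro add_mono mult_left_mono) auto
      finally have N: "\<bar>\<mu>h * \<tau> + z $ 3\<bar> \<le> (\<mu>h + 1) * norm z" by (simp add: algebra_simps)
      have "norm (S y *v z) \<le> (Rn * c) * (\<mu>h * ((\<mu>h + (\<mu>h + 1 / \<mu>) * 2 + 1) * norm z) + (\<mu>h + 1) * norm z)"
        unfolding slide(5) t_def[symmetric] r_def[symmetric] \<tau>_def[symmetric] norm_scaleR
      proof (intro mult_mono)
        show "norm (tn_vec (\<mu>h *\<^sub>R (\<mu>h *\<^sub>R \<tau> *\<^sub>R t + (s y / r) *\<^sub>R (tangential z - \<tau> *\<^sub>R t) + z $ 3 *\<^sub>R t))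
             (\<mu>h * \<tau> + z $ 3))
          \<le> \<mu>h * ((\<mu>h + (\<mu>h + 1 / \<mu>) * 2 + 1) * norm z) + (\<mu>h + 1) * norm z"
          apply (rule order_trans[OF norm_le_tn])
          unfolding tangential_tn_vec tn_vec_3 norm_scaleR
          using T N muh_pos by (intro add_mono mult_mono) auto
      qed (use Rn_pos c_pos in auto)
      also have "\<dots> = (K - (Rt + Rn)) * norm z" by (simp add: K_def algebra_simps)
      also have "\<dots> \<le> K * norm z" using Rt_pos Rn_pos by (intro mult_right_mono) auto
      finally show ?thesis .
    qed
  qed
  then show ?thesis by blast
qed

text \<open>While sliding, \<open>R *v (y - proj y)\<close> is a multiple of the outward normal
  \<open>(t, - \<mu>)\<close> of the cone, with \<open>t\<close> the tangential direction of
  \<open>y\<close>. The last factor vanishes at \<open>x = proj y\<close> and is nonpositive on the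
  cone; \<open>slide_gap\<close> makes the multiple nonnegative.\<close>

lemma proj_polar_aux:
  assumes "\<mu> * y $ 3 < norm (tangential y)" "tangential y \<noteq> 0" "proj y = slide_proj \<mu> Rt Rn y"
  shows "(y - proj y) \<bullet> (R *v x) = Rt * (norm (tangential y) - \<mu> * c * s y) *
    (sgn (tangential y) \<bullet> tangential x - \<mu> * x $ 3)"
proof -
  define r t where "r = norm (tangential y)" and "t = sgn (tangential y)"
  have a: "tangential y = r *\<^sub>R t" using assms by (simp add: r_def t_def sgn_div_norm)
  have p: "proj y = tn_vec ((\<mu> * c * s y) *\<^sub>R t) (c * s y)"
    by (simp add: assms slide_proj_eq t_def sgn_div_norm divide_inverse)
  have "Rn * (y $ 3 - c * s y) = - Rt * \<mu> * (r - \<mu> * c * s y)"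
  proof -
    have "Rn * (c * s y) + \<mu> * (Rn * \<mu>h) * (c * s y) = Rn * ((c * (1 + \<mu> * \<mu>h)) * s y)"
      by (simp add: algebra_simps)
    also have "\<dots> = Rn * s y" by (simp only: mu_c mult_1)
    finally have "Rn * s y = Rn * (c * s y) + \<mu> * (Rn * \<mu>h) * (c * s y)" by (rule sym)
    moreover have "Rn * s y = (Rn * \<mu>h) * r + Rn * y $ 3" by (simp add: s_def r_def algebra_simps)
    ultimately show ?thesis unfolding muh_Rn by (simp add: algebra_simps)
  qed
  then have "(y $ 3 - c * s y) * (Rn * x $ 3) = - Rt * \<mu> * (r - \<mu> * c * s y) * x $ 3"
    by (metis mult.assoc mult.commute)
  then show ?thesis
    unfolding t_def[symmetric] r_def[symmetric] p
    by (simp add: inner_tn[of "_ - _"] tangential_diff a R_block_mult algebra_simps)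
qed

lemma slide_gap:
  assumes "\<mu> * y $ 3 \<le> norm (tangential y)"
  shows "0 \<le> norm (tangential y) - \<mu> * c * s y"
proof -
  have "norm (tangential y) = c * (1 + \<mu> * \<mu>h) * norm (tangential y)" by (simp only: mu_c mult_1)
  then have "norm (tangential y) - \<mu> * c * s y = c * (norm (tangential y) - \<mu> * y $ 3)"
    by (simp add: s_def algebra_simps)
  then show ?thesis using assms c_pos by simp
qed

lemma proj_orthogonal: "(y - proj y) \<bullet> (R *v proj y) = 0"
proof (cases y rule: proj_cases)
  case slide
  then have "sgn (tangential y) \<bullet> tangential (proj y) = \<mu> * proj y $ 3"
    by (simp add: slide_proj_eq sgn_inner_self)
  then show ?thesis by (simp add: proj_polar_aux[OF slide(1,3,4)])
qed simp_all

lemma proj_polar: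
  assumes "norm (tangential x) \<le> \<mu> * x $ 3"
  shows "(y - proj y) \<bullet> (R *v x) \<le> 0"
proof (cases y rule: proj_cases)
  case sep
  have x3: "0 \<le> x $ 3" using assms \<mu>_pos by (smt (verit) norm_ge_zero zero_le_mult_iff)
  \<comment> \<open>Both terms are compared with
    \<open>Rn * \<mu>h * norm (tangential y) * x $ 3\<close>, using
    \<open>Rn * \<mu>h = Rt * \<mu>\<close>.\<close>
  have "tangential y \<bullet> tangential x \<le> norm (tangential y) * (\<mu> * x $ 3)"
    using assms by (meson mult_left_mono norm_cauchy_schwarz norm_ge_zero order_trans)
  then have "Rt * (tangential y \<bullet> tangential x) \<le> Rn * \<mu>h * norm (tangential y) * x $ 3"
    unfolding muh_Rn using Rt_pos by (simp add: mult_ac)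
  moreover have "Rn * y $ 3 * x $ 3 \<le> Rn * (- \<mu>h * norm (tangential y)) * x $ 3"
    using sep x3 Rn_pos by (intro mult_right_mono mult_left_mono) auto
  ultimately show ?thesis
    by (simp add: sep R_block_mult inner_tn[of y "tn_vec _ _"] mult_ac)
next
  case slide
  have "sgn (tangential y) \<bullet> tangential x \<le> \<mu> * x $ 3"
    using norm_cauchy_schwarz[of "sgn (tangential y)" "tangential x"] assms slide by (simp add: norm_sgn)
  then show ?thesis using slide_gap[of y] slide(1) Rt_pos
    unfolding proj_polar_aux[OF slide(1,3,4)]
    by (intro mult_nonneg_nonpos mult_nonneg_nonneg) auto
qed simp

text \<open>Extends the zero branch, whose guard is strict, to its boundary: there the sliding
  formula vanishes because \<open>s y = 0\<close>, and sticking leaves only the apex.\<close>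

lemma proj_eq_0:
  assumes "y $ 3 \<le> - \<mu>h * norm (tangential y)"
  shows "proj y = 0"
proof (cases y rule: proj_cases)
  case stick
  have "y $ 3 \<le> 0" using assms muh_pos by (smt (verit) mult_minus_left mult_nonneg_nonneg norm_ge_zero)
  moreover have "0 \<le> y $ 3"
    using stick \<mu>_pos by (smt (verit) norm_ge_zero zero_le_mult_iff)
  ultimately have "y $ 3 = 0" by simp
  with stick have "y = 0" by (intro vec3_eqI) (simp_all add: tangential_zero)
  then show ?thesis using stick by simp
next
  case slide
  then have "s y = 0" using assms by (simp add: s_def)
  then show ?thesis by (intro vec3_eqI) (simp_all add: slide(4) slide_proj_eq tangential_zero)
qed

text \<open>The sliding case of \<open>S_semismooth\<close>: \<open>y\<close> slides, while
  \<open>y0\<close> may lie on the boundary of the sliding region. The assumption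
  \<open>near\<close> keeps \<open>tangential y\<close> away from 0, so that its direction varies in
  a Lipschitz way.\<close>

lemma S_slide_remainder:
  assumes y: "\<mu> * y $ 3 < norm (tangential y)" "0 \<le> s y" "tangential y \<noteq> 0"
    and y0: "\<mu> * y0 $ 3 \<le> norm (tangential y0)" "0 \<le> s y0" "tangential y0 \<noteq> 0"
    and near: "norm (y - y0) \<le> norm (tangential y0) / 2"
  shows "norm (S y *v y0 - R *v proj y0)
    \<le> Rn * c * (\<mu>h * (10 * (norm (tangential y0) + \<bar>y0 $ 3\<bar>) / (norm (tangential y0))\<^sup>2) + \<mu>h / norm (tangential y0))
       * (norm (y - y0))\<^sup>2"
proof -
  define a x b q u where "a = tangential y0" and "x = tangential y" and "b = y0 $ 3" and "q = y $ 3"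
    and "u = norm (y - y0)"
  define r \<alpha> where "r = norm x" and "\<alpha> = norm a"
  note defs = a_def[symmetric] x_def[symmetric] b_def[symmetric] q_def[symmetric]
    u_def[symmetric] r_def[symmetric] \<alpha>_def[symmetric]
  define M where "M = \<alpha> + \<bar>b\<bar>"
  have \<alpha>: "\<alpha> > 0" and r: "r > 0" using y y0 by (simp_all add: \<alpha>_def r_def a_def x_def)
  have nx: "norm x = r" and na: "norm a = \<alpha>" by (simp_all add: \<alpha>_def r_def)
  have x: "x = r *\<^sub>R sgn x" and a: "a = \<alpha> *\<^sub>R sgn a"
    using r \<alpha> by (simp_all add: sgn_div_norm nx na)
  have u: "u \<ge> 0" "norm (a - x) \<le> u" "\<bar>b - q\<bar> \<le> u" "u \<le> \<alpha> / 2"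
    using norm_tangential_le[of "y - y0"] component_le_norm_cart[of "y - y0" 3] near
    by (simp_all add: defs tangential_diff norm_minus_commute abs_minus_commute)
  have ra: "\<bar>r - \<alpha>\<bar> \<le> u" using norm_triangle_ineq3[of a x] u by (simp add: nx na)
  then have r2: "\<alpha> / 2 \<le> r" using u by linarith
  have qM: "\<bar>q\<bar> \<le> M" using u \<alpha> by (simp add: M_def)
  have M: "M > 0" using \<alpha> by (simp add: M_def)
  \<comment> \<open>The loss from projecting \<open>a\<close> onto the direction of
    \<open>x\<close>. It is of second order, since
    \<open>2 * r * n = (norm (a - x))^2 - (r - \<alpha>)^2\<close>.\<close>
  define n where "n = \<alpha> - sgn x \<bullet> a"
  have n0: "0 \<le> n" using norm_cauchy_schwarz[of "sgn x" a] r nx by (auto simp: n_def na norm_sgn)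
  have "2 * r * n = 2 * (r * \<alpha>) - 2 * (x \<bullet> a)"
    unfolding n_def by (subst (2) x) (simp add: algebra_simps)
  also have "\<dots> \<le> (norm (a - x))\<^sup>2"
  proof -
    have "(norm (a - x))\<^sup>2 = a \<bullet> a - 2 * (x \<bullet> a) + x \<bullet> x"
      by (simp add: power2_norm_eq_inner inner_diff_left inner_diff_right inner_commute)
    also have "\<dots> = \<alpha>\<^sup>2 - 2 * (x \<bullet> a) + r\<^sup>2" by (simp add: dot_square_norm nx na)
    finally show ?thesis using zero_le_power2[of "r - \<alpha>"] by (simp add: power2_diff mult_ac)
  qed
  also have "\<dots> \<le> u\<^sup>2" using u by (intro power_mono) auto
  finally have rn: "2 * r * n \<le> u\<^sup>2" .
  have n: "n \<le> u\<^sup>2 / \<alpha>"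
  proof -
    have "\<alpha> * n \<le> 2 * r * n" using r2 n0 by (intro mult_right_mono) auto
    then show ?thesis using rn \<alpha> by (simp add: pos_le_divide_eq mult.commute)
  qed
  have e: "norm (sgn a - sgn x) \<le> 4 * u / \<alpha>"
  proof -
    have "\<alpha> *\<^sub>R (sgn a - sgn x) = (a - x) + (r - \<alpha>) *\<^sub>R sgn x"
      unfolding scaleR_diff_right a[symmetric] scaleR_diff_left x[symmetric] by simp
    then have "\<alpha> * norm (sgn a - sgn x) = norm ((a - x) + (r - \<alpha>) *\<^sub>R sgn x)"
      using \<alpha> by (metis norm_scaleR abs_of_pos)
    also have "\<dots> \<le> norm (a - x) + \<bar>r - \<alpha>\<bar>"
      using norm_triangle_ineq[of "a - x" "(r - \<alpha>) *\<^sub>R sgn x"] r nx by (auto simp: norm_sgn)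
    also have "\<dots> \<le> 4 * u" using u ra by linarith
    finally show ?thesis using \<alpha> by (simp add: field_simps)
  qed
  define T where "T = (q / r) *\<^sub>R (a - (sgn x \<bullet> a) *\<^sub>R sgn x) - b *\<^sub>R (sgn a - sgn x)"
  \<comment> \<open>This form shows that \<open>T\<close> is of second order: a product of two
    first-order factors, plus a multiple of \<open>n\<close>.\<close>
  have "T = ((q * \<alpha> - b * r) / r) *\<^sub>R (sgn a - sgn x) + (q / r * n) *\<^sub>R sgn x"
  proof -
    have "a - (sgn x \<bullet> a) *\<^sub>R sgn x = \<alpha> *\<^sub>R (sgn a - sgn x) + n *\<^sub>R sgn x"
      unfolding n_def scaleR_diff_right a[symmetric] by (simp add: algebra_simps)
    moreover have "(q * \<alpha> - b * r) / r = q / r * \<alpha> - b" using r by (simp add: field_simps)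
    ultimately show ?thesis by (simp only: T_def) (simp add: algebra_simps)
  qed
  then have "norm T \<le> \<bar>(q * \<alpha> - b * r) / r\<bar> * norm (sgn a - sgn x) + \<bar>q / r * n\<bar>"
    using norm_triangle_ineq[of "((q * \<alpha> - b * r) / r) *\<^sub>R (sgn a - sgn x)" "(q / r * n) *\<^sub>R sgn x"] r nx
    by (auto simp: norm_sgn)
  also have "\<dots> \<le> (2 * M * u / \<alpha>) * (4 * u / \<alpha>) + (2 * M / \<alpha>) * (u\<^sup>2 / \<alpha>)"
  proof (intro add_mono mult_mono e)
    \<comment> \<open>Inserting \<open>b * \<alpha>\<close> exposes the differences
      \<open>q - b\<close> and \<open>\<alpha> - r\<close>, each at most \<open>u\<close> in
      absolute value.\<close>
    have "\<bar>q * \<alpha> - b * r\<bar> = \<bar>(q - b) * \<alpha> + b * (\<alpha> - r)\<bar>" by (simp add: algebra_simps)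
    also have "\<dots> \<le> \<bar>(q - b) * \<alpha>\<bar> + \<bar>b * (\<alpha> - r)\<bar>" by (rule abs_triangle_ineq)
    also have "\<dots> \<le> u * \<alpha> + \<bar>b\<bar> * u"
      unfolding abs_mult using u ra \<alpha> by (intro add_mono mult_mono) auto
    also have "\<dots> = M * u" by (simp add: M_def algebra_simps)
    finally have "\<bar>(q * \<alpha> - b * r) / r\<bar> \<le> M * u / r" using r by (simp add: divide_right_mono)
    also have "\<dots> \<le> M * u / (\<alpha> / 2)" using r2 \<alpha> M u by (intro divide_left_mono) auto
    finally show "\<bar>(q * \<alpha> - b * r) / r\<bar> \<le> 2 * M * u / \<alpha>" by (simp add: mult_ac)
    have "\<bar>q\<bar> / r \<le> M / (\<alpha> / 2)" using r2 \<alpha> M qM by (intro frac_le) auto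
    then have "\<bar>q / r\<bar> * \<bar>n\<bar> \<le> 2 * M / \<alpha> * (u\<^sup>2 / \<alpha>)"
      using n n0 r \<alpha> M by (intro mult_mono) (auto simp: mult.commute)
    then show "\<bar>q / r * n\<bar> \<le> 2 * M / \<alpha> * (u\<^sup>2 / \<alpha>)" by (simp only: abs_mult)
  qed (use M u \<alpha> in auto)
  also have "\<dots> = (10 * M / \<alpha>\<^sup>2) * u\<^sup>2" by (simp add: power2_eq_square)
  finally have T: "norm T \<le> (10 * M / \<alpha>\<^sup>2) * u\<^sup>2" .
  \<comment> \<open>The lower-order terms cancel because \<open>s y / r = \<mu>h + q / r\<close>,
    \<open>s y0 = \<mu>h * \<alpha> + b\<close> and
    \<open>a = \<alpha> *\<^sub>R sgn a\<close>.\<close>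
  have "S y *v y0 - R *v proj y0 = (Rn * c) *\<^sub>R tn_vec (\<mu>h *\<^sub>R T) (- (\<mu>h * n))"
  proof (cases y rule: proj_cases)
    case slide
    have sy: "s y / r = \<mu>h + q / r" using r by (simp add: s_def defs field_simps)
    have sy0: "s y0 = \<mu>h * \<alpha> + b" by (simp add: s_def defs)
    have "\<mu>h *\<^sub>R (sgn x \<bullet> a) *\<^sub>R sgn x + (\<mu>h + q / r) *\<^sub>R (a - (sgn x \<bullet> a) *\<^sub>R sgn x) + b *\<^sub>R sgn x
        - (\<mu>h * \<alpha> + b) *\<^sub>R sgn a = T + \<mu>h *\<^sub>R (a - \<alpha> *\<^sub>R sgn a)"
      by (simp add: T_def algebra_simps)
    also have "a - \<alpha> *\<^sub>R sgn a = 0" using a by (simp only: right_minus_eq)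
    finally have eq: "T = \<mu>h *\<^sub>R (sgn x \<bullet> a) *\<^sub>R sgn x + (\<mu>h + q / r) *\<^sub>R (a - (sgn x \<bullet> a) *\<^sub>R sgn x) + b *\<^sub>R sgn x
        - (\<mu>h * \<alpha> + b) *\<^sub>R sgn a" unfolding scaleR_zero_right add_0_right by (rule sym)
    show ?thesis
      unfolding slide(5) R_slide_proj[OF y0] defs sy sy0
      by (intro vec3_eqI, unfold eq)
        (simp_all add: n_def tangential_diff tangential_scaleR scaleR_diff_right mult_ac, simp_all add: algebra_simps)
  qed (use y in \<open>auto simp: s_def\<close>)
  then have "norm (S y *v y0 - R *v proj y0) = Rn * c * norm (tn_vec (\<mu>h *\<^sub>R T) (- (\<mu>h * n)))"
    using Rn_pos c_pos by simp
  also have "\<dots> \<le> Rn * c * (\<mu>h * ((10 * M / \<alpha>\<^sup>2) * u\<^sup>2) + \<mu>h * (u\<^sup>2 / \<alpha>))"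
  proof (rule mult_left_mono)
    have "norm (tn_vec (\<mu>h *\<^sub>R T) (- (\<mu>h * n))) \<le> \<mu>h * norm T + \<mu>h * n"
      using norm_le_tn[of "tn_vec (\<mu>h *\<^sub>R T) (- (\<mu>h * n))"] muh_pos n0 by (simp add: abs_mult)
    also have "\<dots> \<le> \<mu>h * ((10 * M / \<alpha>\<^sup>2) * u\<^sup>2) + \<mu>h * (u\<^sup>2 / \<alpha>)"
      using T n muh_pos by (intro add_mono mult_left_mono) auto
    finally show "norm (tn_vec (\<mu>h *\<^sub>R T) (- (\<mu>h * n))) \<le> \<mu>h * ((10 * M / \<alpha>\<^sup>2) * u\<^sup>2) + \<mu>h * (u\<^sup>2 / \<alpha>)" .
  qed (use Rn_pos c_pos in auto)
  also have "\<dots> = Rn * c * (\<mu>h * (10 * M / \<alpha>\<^sup>2) + \<mu>h / \<alpha>) * u\<^sup>2"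
    by (simp add: algebra_simps)
  finally show ?thesis by (simp only: M_def r_def \<alpha>_def a_def b_def u_def)
qed

lemma continuous_on_tn [continuous_intros]:
  "continuous_on UNIV (\<lambda>y. norm (tangential y))" "continuous_on UNIV s"
  unfolding s_def
  by (intro continuous_intros bounded_linear.continuous_on[OF bounded_linear_tangential])+

lemma eventually_less_nhds:
  fixes f g :: "real ^ 3 \<Rightarrow> real"
  assumes "continuous_on UNIV f" "continuous_on UNIV g" "f y0 < g y0"
  shows "\<forall>\<^sub>F y in nhds y0. f y < g y"
  using eventually_nhds_in_open[OF open_Collect_less[OF assms(1,2)]] assms(3) by simp

text \<open>Since \<open>S y *v y = R *v proj y\<close>, the left-hand side is the linearization error
  \<open>R *v proj y0 - R *v proj y - S y *v (y0 - y)\<close> up to sign: \<open>proj\<close> is strongly semismooth.\<close>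

lemma S_semismooth:
  "\<exists>C. \<forall>\<^sub>F y in nhds y0. norm (S y *v y0 - R *v proj y0) \<le> C * (norm (y - y0))\<^sup>2"
proof -
  \<comment> \<open>The sticking region is closed, so a sticking \<open>y\<close> near
    \<open>y0\<close> forces \<open>y0\<close> to stick, and then \<open>S y *v y0 = R *v y0\<close>
    is exact.\<close>
  have stick: "\<forall>\<^sub>F y in nhds y0. norm (tangential y) \<le> \<mu> * y $ 3 \<longrightarrow> proj y0 = y0"
  proof (cases "norm (tangential y0) \<le> \<mu> * y0 $ 3")
    case True
    then show ?thesis by (simp add: block_proj_def)
  next
    case False
    then have "\<forall>\<^sub>F y in nhds y0. \<mu> * y $ 3 < norm (tangential y)"
      by (intro eventually_less_nhds continuous_intros) auto
    then show ?thesis by eventually_elim auto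
  qed
  \<comment> \<open>A separated \<open>y\<close> near \<open>y0\<close> forces
    \<open>s y0 \<le> 0\<close>; then both terms of the error are 0.\<close>
  have sep: "\<forall>\<^sub>F y in nhds y0. y $ 3 < - \<mu>h * norm (tangential y) \<longrightarrow> proj y0 = 0"
  proof (cases "0 < s y0")
    case True
    then have "\<forall>\<^sub>F y in nhds y0. 0 < s y"
      by (intro eventually_less_nhds continuous_intros) auto
    then show ?thesis by eventually_elim (auto simp: s_def)
  qed (simp add: proj_eq_0 s_def)
  have "\<exists>C. \<forall>\<^sub>F y in nhds y0. \<mu> * y $ 3 < norm (tangential y) \<and> 0 \<le> s y \<and> tangential y \<noteq> 0 \<longrightarrow>
    norm (S y *v y0 - R *v proj y0) \<le> C * (norm (y - y0))\<^sup>2"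
  proof -
    \<comment> \<open>In the first two cases no point near \<open>y0\<close> slides, at the apex
      both terms vanish, and the last case is that of \<open>S_slide_remainder\<close>.\<close>
    consider "norm (tangential y0) < \<mu> * y0 $ 3" | "s y0 < 0" | "y0 = 0"
      | "\<mu> * y0 $ 3 \<le> norm (tangential y0)" "0 \<le> s y0" "tangential y0 \<noteq> 0"
    proof (cases "tangential y0 = 0")
      case True
      then consider "y0 $ 3 > 0" | "y0 $ 3 < 0" | "y0 = 0"
        by (metis linorder_neqE_linordered_idom tangential_zero vec3_eqI zero_index)
      then show thesis using that(1-3) True \<mu>_pos by cases (auto simp: s_def)
    next
      case False
      then show thesis using that by linarith
    qed
    then show ?thesis
    proof cases
      case 1
      then have "\<forall>\<^sub>F y in nhds y0. norm (tangential y) < \<mu> * y $ 3"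
        by (intro eventually_less_nhds continuous_intros) auto
      then have "\<forall>\<^sub>F y in nhds y0. \<mu> * y $ 3 < norm (tangential y) \<and> 0 \<le> s y \<and> tangential y \<noteq> 0 \<longrightarrow>
        norm (S y *v y0 - R *v proj y0) \<le> 0 * (norm (y - y0))\<^sup>2" by eventually_elim auto
      then show ?thesis by blast
    next
      case 2
      then have "\<forall>\<^sub>F y in nhds y0. s y < 0"
        by (intro eventually_less_nhds continuous_intros) auto
      then have "\<forall>\<^sub>F y in nhds y0. \<mu> * y $ 3 < norm (tangential y) \<and> 0 \<le> s y \<and> tangential y \<noteq> 0 \<longrightarrow>
        norm (S y *v y0 - R *v proj y0) \<le> 0 * (norm (y - y0))\<^sup>2" by eventually_elim auto
      then show ?thesis by blast
    next
      case 3
      then have "proj y0 = 0" by (simp add: block_proj_def tangential_zero)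
      then show ?thesis using 3 by (intro exI[of _ 0]) simp
    next
      case 4
      have "\<forall>\<^sub>F y in nhds y0. norm (y - y0) < norm (tangential y0) / 2"
        using 4 by (intro eventually_less_nhds continuous_intros) auto
      then have "\<forall>\<^sub>F y in nhds y0. norm (y - y0) \<le> norm (tangential y0) / 2"
        by eventually_elim auto
      moreover define C where "C = Rn * c * (\<mu>h * (10 * (norm (tangential y0) + \<bar>y0 $ 3\<bar>)
        / (norm (tangential y0))\<^sup>2) + \<mu>h / norm (tangential y0))"
      ultimately have "\<forall>\<^sub>F y in nhds y0. \<mu> * y $ 3 < norm (tangential y) \<and> 0 \<le> s y \<and> tangential y \<noteq> 0 \<longrightarrow>
        norm (S y *v y0 - R *v proj y0) \<le> C * (norm (y - y0))\<^sup>2"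
        using S_slide_remainder[OF _ _ _ 4, folded C_def] by (auto elim: eventually_mono)
      then show ?thesis by (intro exI[where x = C])
    qed
  qed
  then obtain C where C: "\<forall>\<^sub>F y in nhds y0. \<mu> * y $ 3 < norm (tangential y) \<and> 0 \<le> s y \<and> tangential y \<noteq> 0 \<longrightarrow>
    norm (S y *v y0 - R *v proj y0) \<le> C * (norm (y - y0))\<^sup>2" by blast
  \<comment> \<open>The constant is made nonnegative to cover the other two regions, where the error
    is 0.\<close>
  from stick sep C
  have "\<forall>\<^sub>F y in nhds y0. norm (S y *v y0 - R *v proj y0) \<le> max 0 C * (norm (y - y0))\<^sup>2"
  proof eventually_elim
    case (elim y)
    show ?case
    proof (cases y rule: proj_cases)
      case slide
      then have "norm (S y *v y0 - R *v proj y0) \<le> C * (norm (y - y0))\<^sup>2" using elim by blast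
      then show ?thesis by (meson max.cobounded2 mult_right_mono order_trans zero_le_power2)
    qed (use elim in auto)
  qed
  then show ?thesis by blast
qed

end

section \<open>The stacked problem\<close>

lemma contact_block_component [simp]: "contact_block x i $ k = x $ (i, k)"
  by (simp add: contact_block_def)

lemma contact_block_add: "contact_block (x + y) i = contact_block x i + contact_block y i"
  and contact_block_diff: "contact_block (x - y) i = contact_block x i - contact_block y i"
  and contact_block_minus: "contact_block (- x) i = - contact_block x i"
  by (simp_all add: vec_eq_iff)

lemma contact_block_eqI: "(\<And>i. contact_block x i = contact_block y i) \<Longrightarrow> x = y"
  by (simp add: vec_eq_iff)

lemma contact_block_diag: "contact_block (block_diag B *v x) i = B i *v contact_block x i"
proof (subst vec_eq_iff, rule allI)
  fix k
  have "contact_block (block_diag B *v x) i $ k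
      = (\<Sum>j\<in>UNIV. \<Sum>l\<in>UNIV. (if i = j then B i $ k $ l else 0) * x $ (j, l))"
    by (simp add: block_diag_def matrix_vector_mult_def sum.cartesian_product split_beta
        UNIV_Times_UNIV[symmetric] del: UNIV_Times_UNIV cong: if_cong)
  also have "\<dots> = (\<Sum>j\<in>UNIV. if i = j then \<Sum>l\<in>UNIV. B i $ k $ l * x $ (j, l) else 0)"
    by (intro sum.cong refl) auto
  finally show "contact_block (block_diag B *v x) i $ k = (B i *v contact_block x i) $ k"
    by (simp add: matrix_vector_mult_def)
qed

lemma inner_contact_block: "x \<bullet> y = (\<Sum>i\<in>UNIV. contact_block x i \<bullet> contact_block y i)"
  by (simp add: inner_vec_def sum.cartesian_product split_beta
      UNIV_Times_UNIV[symmetric] del: UNIV_Times_UNIV)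

lemma norm_contact_blocks: "norm x = L2_set (\<lambda>i. norm (contact_block x i)) UNIV"
  unfolding L2_set_def norm_eq_sqrt_inner[of x] inner_contact_block[of x x]
  by (simp add: power2_norm_eq_inner)

lemma norm_le_sum_blocks: "norm x \<le> (\<Sum>i\<in>UNIV. norm (contact_block x i))"
  unfolding norm_contact_blocks by (rule L2_set_le_sum) simp

lemma norm_contact_block_le: "norm (contact_block x i) \<le> norm x"
  unfolding norm_contact_blocks[of x] by (rule member_le_L2_set[of UNIV]) auto

lemma bounded_linear_contact_block: "bounded_linear (\<lambda>x. contact_block x i)"
  by (rule bounded_linear_intro[where K = 1])
    (auto simp: contact_block_add norm_contact_block_le vec_eq_iff)

lemma R_block_selfadjoint: "x \<bullet> (R_block a b *v y) = (R_block a b *v x) \<bullet> y"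
  by (simp add: R_block_mult inner_tn[of x "tn_vec _ _"] inner_tn[of "tn_vec _ _" y])

lemma R_matrix_selfadjoint: "x \<bullet> (R_matrix Rt Rn *v y) = (R_matrix Rt Rn *v x) \<bullet> y"
  by (simp add: inner_contact_block R_matrix_def contact_block_diag R_block_selfadjoint)

lemma R_matrix_mult_inverse:
  assumes "\<And>i. Rt i \<noteq> 0" "\<And>i. Rn i \<noteq> 0"
  shows "R_matrix Rt Rn *v (R_matrix (\<lambda>i. 1 / Rt i) (\<lambda>i. 1 / Rn i) *v x) = x"
  by (rule contact_block_eqI, rule vec3_eqI)
    (simp_all add: R_matrix_def contact_block_diag R_block_mult assms del: contact_block_component)

lemma R_matrix_inverse:
  fixes Rt Rn :: "'c::finite \<Rightarrow> real"
  assumes "\<And>i. Rt i \<noteq> 0" "\<And>i. Rn i \<noteq> 0"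
  shows "matrix_inv (R_matrix Rt Rn) = R_matrix (\<lambda>i. 1 / Rt i) (\<lambda>i. 1 / Rn i)"
  using R_matrix_mult_inverse[of "\<lambda>i. 1 / Rt i" "\<lambda>i. 1 / Rn i"] assms
  by (intro matrix_inv_eqI) (simp add: matrix_eq matrix_vector_mul_assoc[symmetric])

section \<open>Bounds for matrices and quadratic forms\<close>

lemma inner_transpose_mult: "x \<bullet> (transpose M *v y) = (M *v x) \<bullet> (y :: real ^ 'm)"
  for M :: "real ^ 'n ^ 'm"
  by (metis dot_lmul_matrix inner_commute transpose_matrix_vector)

lemma matrix_bound:
  fixes M :: "real ^ 'k ^ 'm"
  obtains K where "0 < K" "\<And>z. norm (M *v z) \<le> K * norm z"
  using bounded_linear.pos_bounded[OF matrix_vector_mul_bounded_linear[of M]] by (auto simp: mult.commute)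

lemma quadratic_form_bounded:
  fixes Q :: "real ^ 'n ^ 'n"
  obtains K where "0 < K" "\<And>z. z \<bullet> (Q *v z) \<le> K * (norm z)\<^sup>2"
proof -
  obtain K where K: "0 < K" "\<And>z. norm (Q *v z) \<le> K * norm z" using matrix_bound[of Q] by blast
  have "z \<bullet> (Q *v z) \<le> K * (norm z)\<^sup>2" for z
  proof -
    have "z \<bullet> (Q *v z) \<le> norm z * norm (Q *v z)" by (rule norm_cauchy_schwarz)
    also have "\<dots> \<le> norm z * (K * norm z)" by (intro mult_left_mono K) simp
    finally show ?thesis by (simp add: power2_eq_square mult_ac)
  qed
  with K(1) that show thesis by blast
qed

lemma sym_pos_def_coercive:
  fixes A :: "real ^ 'n ^ 'n"
  assumes "sym_pos_def A"
  obtains \<sigma> where "0 < \<sigma>" "\<And>z. \<sigma> * (norm z)\<^sup>2 \<le> z \<bullet> (A *v z)"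
proof -
  let ?S = "sphere 0 1 :: (real ^ 'n) set"
  have "continuous_on ?S (\<lambda>z. z \<bullet> (A *v z))"
    by (intro continuous_intros linear_continuous_on matrix_vector_mul_bounded_linear)
  moreover have "axis undefined 1 \<in> ?S" by simp
  ultimately obtain x where x: "x \<in> ?S" "\<And>z. z \<in> ?S \<Longrightarrow> x \<bullet> (A *v x) \<le> z \<bullet> (A *v z)"
    using continuous_attains_inf[of ?S "\<lambda>z. z \<bullet> (A *v z)"] by (metis compact_sphere empty_iff)
  define \<sigma> where "\<sigma> = x \<bullet> (A *v x)"
  have "x \<noteq> 0" using x(1) by auto
  then have "\<sigma> > 0" using assms unfolding sym_pos_def_def \<sigma>_def by blast
  moreover have "\<sigma> * (norm z)\<^sup>2 \<le> z \<bullet> (A *v z)" for z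
  proof (cases "z = 0")
    case False
    have "\<sigma> \<le> (z /\<^sub>R norm z) \<bullet> (A *v (z /\<^sub>R norm z))" unfolding \<sigma>_def by (rule x(2)) (use False in simp)
    also have "\<dots> = (z \<bullet> (A *v z)) / (norm z)\<^sup>2"
      by (simp add: matrix_vector_mult_scaleR power2_eq_square divide_inverse mult_ac)
    finally show ?thesis using False by (simp add: field_simps)
  qed simp
  ultimately show thesis using that by blast
qed

text \<open>In the inner product given by \<open>R\<close>, the first gap equals half the squared
  norm of \<open>p' - p\<close> minus the product of \<open>q'\<close> and \<open>p\<close>; the
  second equals half the squared norm of \<open>q' - q\<close> minus the product of \<open>q\<close>
  and \<open>p'\<close>. Polarity makes both nonnegative.\<close>

lemma moreau_bounds:
  fixes R :: "real ^ 'm ^ 'm"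
  assumes sym: "\<And>x y. x \<bullet> (R *v y) = y \<bullet> (R *v x)" and psd: "\<And>x. 0 \<le> x \<bullet> (R *v x)"
    and "q \<bullet> (R *v p) = 0" "q' \<bullet> (R *v p') = 0" "q \<bullet> (R *v p') \<le> 0" "q' \<bullet> (R *v p) \<le> 0"
  defines "h \<equiv> (p' + q') - (p + q)"
  shows "1/2 * (p \<bullet> (R *v p)) + h \<bullet> (R *v p) \<le> 1/2 * (p' \<bullet> (R *v p'))"
    and "1/2 * (p' \<bullet> (R *v p')) \<le> 1/2 * (p \<bullet> (R *v p)) + h \<bullet> (R *v p) + 1/2 * (h \<bullet> (R *v h))"
proof -
  note dist = matrix_vector_right_distrib matrix_vector_mult_diff_distrib
    inner_add_left inner_add_right inner_diff_left inner_diff_right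
  show "1/2 * (p \<bullet> (R *v p)) + h \<bullet> (R *v p) \<le> 1/2 * (p' \<bullet> (R *v p'))"
    using psd[of "p' - p"] assms(3-6) sym[of p p'] unfolding h_def dist by linarith
  show "1/2 * (p' \<bullet> (R *v p')) \<le> 1/2 * (p \<bullet> (R *v p)) + h \<bullet> (R *v p) + 1/2 * (h \<bullet> (R *v h))"
    using psd[of "q' - q"] assms(3-6)
      sym[of p p'] sym[of p q] sym[of p q'] sym[of p' q] sym[of p' q'] sym[of q q']
    unfolding h_def dist by argo
qed

section \<open>The projection onto the product cone\<close>

locale sap_problem =
  fixes A :: "real ^ 'n ^ 'n"
    and J :: "real ^ 'n ^ ('c::finite \<times> 3)"
    and v_free :: "real ^ 'n"
    and vc_hat :: "real ^ ('c \<times> 3)"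
    and \<mu> Rt Rn :: "'c \<Rightarrow> real"
  assumes A: "sym_pos_def A"
    and pos: "0 < \<mu> i" "0 < Rt i" "0 < Rn i"
begin

lemma contact: "contact (\<mu> i) (Rt i) (Rn i)"
  by unfold_locales (rule pos)+

abbreviation "R \<equiv> R_matrix Rt Rn"
abbreviation "y \<equiv> y_of J vc_hat Rt Rn"
abbreviation "P \<equiv> cone_proj \<mu> Rt Rn"
abbreviation "G \<equiv> G_matrix J vc_hat \<mu> Rt Rn"
abbreviation "H \<equiv> H_matrix A J vc_hat \<mu> Rt Rn"
abbreviation "cost \<equiv> primal_cost A J v_free vc_hat \<mu> Rt Rn"

lemma A_selfadjoint: "x \<bullet> (A *v z) = z \<bullet> (A *v x)"
  using A inner_transpose_mult[of x A z] by (simp add: sym_pos_def_def inner_commute)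

lemma R_sym: "x \<bullet> (R *v z) = z \<bullet> (R *v x)"
  by (metis R_matrix_selfadjoint inner_commute)

lemma R_block_pos: "x \<noteq> 0 \<Longrightarrow> 0 < x \<bullet> (R_block (Rt i) (Rn i) *v x)"
proof -
  assume x: "x \<noteq> 0"
  then consider "tangential x \<noteq> 0" | "x $ 3 \<noteq> 0" by (metis tangential_zero vec3_eqI zero_index)
  then have "0 < Rt i * (tangential x \<bullet> tangential x) + Rn i * (x $ 3)\<^sup>2"
    using pos[of i] by cases (simp_all add: add_pos_nonneg add_nonneg_pos)
  then show ?thesis by (simp add: R_block_mult inner_tn[of x "tn_vec _ _"] power2_eq_square mult.left_commute)
qed

lemma R_block_nonneg: "0 \<le> x \<bullet> (R_block (Rt i) (Rn i) *v x)"
  using R_block_pos[of x i] by (cases "x = 0") auto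

lemma R_nonneg: "0 \<le> x \<bullet> (R *v x)"
  unfolding inner_contact_block[of x] R_matrix_def contact_block_diag
  by (intro sum_nonneg R_block_nonneg)

lemma R_pos:
  assumes "x \<noteq> 0"
  shows "0 < x \<bullet> (R *v x)"
proof -
  have "\<exists>i. contact_block x i \<noteq> 0"
  proof (rule ccontr)
    assume "\<not> ?thesis"
    then have "x = 0" by (intro contact_block_eqI) (simp add: vec_eq_iff)
    with assms show False by simp
  qed
  then obtain i where "contact_block x i \<noteq> 0" by blast
  then show ?thesis
    unfolding inner_contact_block[of x] R_matrix_def contact_block_diag
    by (intro sum_pos2[of UNIV i] R_block_nonneg R_block_pos) auto
qed

text \<open>As \<open>R\<close> is block diagonal and the cone a product, the projection can be
  taken contact by contact.\<close>

definition stacked_proj :: "real ^ ('c \<times> 3) \<Rightarrow> real ^ ('c \<times> 3)" where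
  "stacked_proj x = (\<chi> p. block_proj (\<mu> (fst p)) (Rt (fst p)) (Rn (fst p)) (contact_block x (fst p)) $ snd p)"

lemma stacked_proj_block:
  "contact_block (stacked_proj x) i = block_proj (\<mu> i) (Rt i) (Rn i) (contact_block x i)"
  by (simp add: vec_eq_iff stacked_proj_def)

lemma stacked_proj_in: "stacked_proj x \<in> friction_cones \<mu>"
  using contact.proj_in_cone[OF contact]
  by (simp add: friction_cones_def friction_cone_def stacked_proj_block del: contact_block_component)

lemma stacked_proj_orthogonal: "(x - stacked_proj x) \<bullet> (R *v stacked_proj x) = 0"
  unfolding inner_contact_block[of "x - _"] R_matrix_def contact_block_diag contact_block_diff stacked_proj_block
  by (intro sum.neutral ballI contact.proj_orthogonal[OF contact])

lemma stacked_proj_polar: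
  assumes "\<gamma> \<in> friction_cones \<mu>"
  shows "(x - stacked_proj x) \<bullet> (R *v \<gamma>) \<le> 0"
  unfolding inner_contact_block[of "x - _"] R_matrix_def contact_block_diag contact_block_diff stacked_proj_block
  using assms by (intro sum_nonpos contact.proj_polar[OF contact])
    (simp add: friction_cones_def friction_cone_def del: contact_block_component)

text \<open>The objective exceeds its value at \<open>p\<close> by at least half the squared
  \<open>R\<close>-distance to \<open>p\<close>. So \<open>p\<close> is the only minimizer and the
  choice in \<open>arg_min\<close> is forced.\<close>

lemma cone_proj_eq: "P x = stacked_proj x"
proof -
  define f where "f \<gamma> = 1/2 * ((\<gamma> - x) \<bullet> (R *v (\<gamma> - x)))" for \<gamma>
  define p where "p = stacked_proj x"
  have f: "f p + 1/2 * ((\<gamma> - p) \<bullet> (R *v (\<gamma> - p))) \<le> f \<gamma>" if "\<gamma> \<in> friction_cones \<mu>" for \<gamma>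
  proof -
    have "(x - p) \<bullet> (R *v (\<gamma> - p)) \<le> 0"
      using stacked_proj_orthogonal[of x] stacked_proj_polar[OF that, of x]
      by (simp add: p_def matrix_vector_mult_diff_distrib inner_diff_right)
    moreover have "f \<gamma> = f p + 1/2 * ((\<gamma> - p) \<bullet> (R *v (\<gamma> - p))) - (x - p) \<bullet> (R *v (\<gamma> - p))"
      using R_sym[of \<gamma> p] R_sym[of \<gamma> x] R_sym[of x p]
      by (simp add: f_def matrix_vector_mult_diff_distrib inner_diff_right inner_diff_left algebra_simps)
    ultimately show ?thesis by simp
  qed
  have "arg_min f (\<lambda>\<gamma>. \<gamma> \<in> friction_cones \<mu>) = p"
  proof (rule arg_minI[where x = p and Q = "\<lambda>\<gamma>. \<gamma> = p"])
    show "p \<in> friction_cones \<mu>" unfolding p_def by (rule stacked_proj_in)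
    show "\<not> f \<gamma> < f p" if "\<gamma> \<in> friction_cones \<mu>" for \<gamma>
      using f[OF that] R_nonneg[of "\<gamma> - p"] by simp
    fix \<gamma> assume "\<gamma> \<in> friction_cones \<mu>" "\<forall>y. y \<in> friction_cones \<mu> \<longrightarrow> \<not> f y < f \<gamma>"
    with \<open>p \<in> friction_cones \<mu>\<close> f[of \<gamma>] have "\<not> 0 < (\<gamma> - p) \<bullet> (R *v (\<gamma> - p))" by fastforce
    then show "\<gamma> = p" using R_pos[of "\<gamma> - p"] by auto
  qed
  moreover have "f = (\<lambda>\<gamma>. 1/2 * ((\<gamma> - x) \<bullet> (R *v (\<gamma> - x))))" by (rule ext) (rule f_def)
  ultimately show ?thesis by (simp only: cone_proj_def arg_min_on_def p_def)
qed

section \<open>Gradient, strong convexity and smoothness of the cost\<close>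

lemma proj_cost_bounds:
  shows "1/2 * sqnorm_wrt R (P x) + (z - x) \<bullet> (R *v P x) \<le> 1/2 * sqnorm_wrt R (P z)"
    and "1/2 * sqnorm_wrt R (P z) \<le> 1/2 * sqnorm_wrt R (P x) + (z - x) \<bullet> (R *v P x)
           + 1/2 * sqnorm_wrt R (z - x)"
  using moreau_bounds[OF R_sym R_nonneg stacked_proj_orthogonal[of x] stacked_proj_orthogonal[of z]
      stacked_proj_polar[OF stacked_proj_in] stacked_proj_polar[OF stacked_proj_in]]
  by (simp_all add: sqnorm_wrt_def cone_proj_eq)

lemma R_y_diff: "R *v (y w - y v) = - (J *v (w - v))"
proof -
  have ne: "Rt i \<noteq> 0" "Rn i \<noteq> 0" for i using pos[of i] by auto
  then show ?thesis
    by (simp add: y_of_def R_matrix_inverse matrix_vector_mult_diff_distrib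
        linear_neg[OF matrix_vector_mul_linear] R_matrix_mult_inverse)
qed

lemma y_diff: "y w - y v = - ((matrix_inv R ** J) *v (w - v))"
  by (simp add: y_of_def matrix_vector_mul_assoc[symmetric] matrix_vector_mult_diff_distrib)

text \<open>The candidate from the chain rule: the projection term has gradient
  \<open>R *v P (y v)\<close> with respect to \<open>y v\<close>, and \<open>R\<close> times the
  derivative of \<open>y\<close> is \<open>- J\<close>. It is confirmed by
  \<open>cost_bounds\<close> through \<open>gderiv_f\<close>.\<close>

definition cost_gradient :: "real ^ 'n \<Rightarrow> real ^ 'n" where
  "cost_gradient v = A *v (v - v_free) - transpose J *v P (y v)"

text \<open>An exact identity whose last bracket is the Moreau remainder;
  \<open>proj_cost_bounds\<close> places it between 0 and
  \<open>1/2 * sqnorm_wrt R (y w - y v)\<close>.\<close>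

lemma cost_expand:
  "cost w = cost v + cost_gradient v \<bullet> (w - v) + 1/2 * ((w - v) \<bullet> (A *v (w - v)))
     + (1/2 * sqnorm_wrt R (P (y w)) - 1/2 * sqnorm_wrt R (P (y v)) - (y w - y v) \<bullet> (R *v P (y v)))"
proof -
  have "(y w - y v) \<bullet> (R *v P (y v)) = - ((w - v) \<bullet> (transpose J *v P (y v)))"
    by (simp add: R_matrix_selfadjoint R_y_diff inner_transpose_mult del: transpose_matrix_vector)
  moreover have "1/2 * sqnorm_wrt A (w - v_free) = 1/2 * sqnorm_wrt A (v - v_free)
      + (w - v) \<bullet> (A *v (v - v_free)) + 1/2 * ((w - v) \<bullet> (A *v (w - v)))"
    using A_selfadjoint[of v w] A_selfadjoint[of v v_free] A_selfadjoint[of w v_free]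
    by (simp add: sqnorm_wrt_def matrix_vector_mult_diff_distrib inner_diff_right inner_diff_left algebra_simps)
  ultimately show ?thesis
    by (simp add: primal_cost_def cost_gradient_def inner_commute[of _ "w - v"] inner_diff_right[of "w - v"])
qed

text \<open>\<open>\<sigma>\<close> is exported with its bound for \<open>A\<close> because
  \<open>newton_line_search\<close> uses one constant for both the cost and
  \<open>H\<close>.\<close>

lemma cost_bounds:
  "\<exists>\<sigma> L. (\<forall>z. \<sigma> * (norm z)\<^sup>2 \<le> z \<bullet> (A *v z)) \<and> strongly_convex_smooth cost cost_gradient \<sigma> L"
proof -
  define M where "M = matrix_inv R ** J"
  obtain \<sigma> where \<sigma>: "0 < \<sigma>" "\<And>z. \<sigma> * (norm z)\<^sup>2 \<le> z \<bullet> (A *v z)" using sym_pos_def_coercive[OF A] by blast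
  obtain L where L: "0 < L" "\<And>z. z \<bullet> ((A + transpose M ** R ** M) *v z) \<le> L * (norm z)\<^sup>2"
    using quadratic_form_bounded by blast
  have "sqnorm_wrt R (y w - y v) = (w - v) \<bullet> ((transpose M ** R ** M) *v (w - v))" for v w
    by (simp add: sqnorm_wrt_def y_diff M_def[symmetric] linear_neg[OF matrix_vector_mul_linear]
        matrix_vector_mul_assoc[symmetric] inner_transpose_mult del: transpose_matrix_vector)
  then have up: "(w - v) \<bullet> (A *v (w - v)) + sqnorm_wrt R (y w - y v) \<le> L * (norm (w - v))\<^sup>2" for v w
    using L(2)[of "w - v"] by (simp add: matrix_vector_mult_add_rdistrib inner_add_right)
  have "strongly_convex_smooth cost cost_gradient \<sigma> L"
  proof
    fix v w
    show "cost v + cost_gradient v \<bullet> (w - v) + \<sigma> / 2 * (norm (w - v))\<^sup>2 \<le> cost w"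
      unfolding cost_expand[of w v] using proj_cost_bounds(1)[of "y v" "y w"] \<sigma>(2)[of "w - v"] by simp
    show "cost w \<le> cost v + cost_gradient v \<bullet> (w - v) + L / 2 * (norm (w - v))\<^sup>2"
      unfolding cost_expand[of w v] using proj_cost_bounds(2)[of "y w" "y v"] up[of w v] by simp
  qed (rule \<sigma> L)+
  with \<sigma>(2) show ?thesis by blast
qed

section \<open>Uniform bounds for \<open>G\<close> and \<open>H\<close>\<close>

lemma G_block: "contact_block (G v *v w) i = R_block (1 / Rt i) (1 / Rn i) *v
    (S_block (\<mu> i) (Rt i) (Rn i) (contact_block (y v) i) *v (R_block (1 / Rt i) (1 / Rn i) *v contact_block w i))"
proof -
  have "Rt i \<noteq> 0" "Rn i \<noteq> 0" using pos[of i] by auto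
  then show ?thesis
    by (simp add: G_matrix_def contact_block_diag R_block_inverse matrix_vector_mul_assoc[symmetric]
        del: contact_block_component)
qed

lemma G_nonneg: "0 \<le> w \<bullet> (G v *v w)"
  unfolding inner_contact_block[of w] G_block R_block_selfadjoint[of "contact_block w _"]
  by (intro sum_nonneg contact.S_nonneg[OF contact])

lemma H_mult: "H v *v z = A *v z + transpose J *v (G v *v (J *v z))"
  by (simp add: H_matrix_def matrix_vector_mult_add_rdistrib matrix_vector_mul_assoc[symmetric]
      del: transpose_matrix_vector)

lemma H_coercive: "z \<bullet> (A *v z) \<le> z \<bullet> (H v *v z)"
  using G_nonneg[of "J *v z" v]
  by (simp add: H_mult inner_add_right inner_transpose_mult del: transpose_matrix_vector)

text \<open>The velocity enters only through \<open>S_block\<close>, for which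
  \<open>S_bounded\<close> is uniform in its argument.\<close>

lemma G_bounded: "\<exists>K. \<forall>v w. norm (G v *v w) \<le> K * norm w"
proof -
  have "\<exists>K. \<forall>v w. norm (contact_block (G v *v w) i) \<le> K * norm w" for i
  proof -
    define N where "N = R_block (1 / Rt i) (1 / Rn i)"
    obtain KN where KN: "0 < KN" "\<And>z. norm (N *v z) \<le> KN * norm z" using matrix_bound[of N] by blast
    obtain KS where KS: "\<And>y z. norm (S_block (\<mu> i) (Rt i) (Rn i) y *v z) \<le> KS * norm z"
      using contact.S_bounded[OF contact] by blast
    have "norm (contact_block (G v *v w) i) \<le> KN * (\<bar>KS\<bar> * (KN * norm w))" for v w
    proof -
      let ?w = "contact_block w i"
      let ?S = "S_block (\<mu> i) (Rt i) (Rn i) (contact_block (y v) i)"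
      have "norm (contact_block (G v *v w) i) \<le> KN * norm (?S *v (N *v ?w))"
        unfolding G_block N_def[symmetric] by (rule KN)
      also have "\<dots> \<le> KN * (\<bar>KS\<bar> * norm (N *v ?w))"
        using KN(1) by (intro mult_left_mono order_trans[OF KS mult_right_mono[OF abs_ge_self norm_ge_zero]]) auto
      also have "\<dots> \<le> KN * (\<bar>KS\<bar> * (KN * norm ?w))"
        using KN by (intro mult_left_mono) auto
      also have "\<dots> \<le> KN * (\<bar>KS\<bar> * (KN * norm w))"
        using KN norm_contact_block_le[of w i] by (intro mult_left_mono) auto
      finally show ?thesis .
    qed
    then show ?thesis by (intro exI[where x = "KN * (\<bar>KS\<bar> * KN)"]) (simp add: mult_ac)
  qed
  then obtain K where K: "\<And>i v w. norm (contact_block (G v *v w) i) \<le> K i * norm w" by metis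
  have "norm (G v *v w) \<le> (\<Sum>i\<in>UNIV. K i) * norm w" for v w
    unfolding sum_distrib_right by (rule order_trans[OF norm_le_sum_blocks]) (intro sum_mono K)
  then show ?thesis by blast
qed

lemma H_bounded: "\<exists>K>0. \<forall>v z. norm (H v *v z) \<le> K * norm z"
proof -
  obtain KA where KA: "0 < KA" "\<And>z. norm (A *v z) \<le> KA * norm z" using matrix_bound[of A] by blast
  obtain KJ where KJ: "0 < KJ" "\<And>z. norm (J *v z) \<le> KJ * norm z" using matrix_bound[of J] by blast
  obtain KT where KT: "0 < KT" "\<And>z. norm (transpose J *v z) \<le> KT * norm z"
    using matrix_bound[of "transpose J"] by blast
  obtain KG where KG: "\<And>v w. norm (G v *v w) \<le> KG * norm w" using G_bounded by blast
  have "norm (H v *v z) \<le> (KA + KT * (\<bar>KG\<bar> * KJ)) * norm z" for v z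
  proof -
    have "norm (G v *v (J *v z)) \<le> \<bar>KG\<bar> * norm (J *v z)"
      using KG[of v "J *v z"] by (meson abs_ge_self mult_right_mono norm_ge_zero order_trans)
    also have "\<dots> \<le> \<bar>KG\<bar> * (KJ * norm z)" using KJ by (intro mult_left_mono) auto
    finally have "KT * norm (G v *v (J *v z)) \<le> KT * (\<bar>KG\<bar> * (KJ * norm z))"
      using KT by (intro mult_left_mono) auto
    then show ?thesis
      using norm_triangle_ineq[of "A *v z" "transpose J *v (G v *v (J *v z))"] KA(2)[of z]
        KT(2)[of "G v *v (J *v z)"]
      unfolding H_mult by (simp add: distrib_right mult.assoc del: transpose_matrix_vector)
  qed
  moreover have "KA + KT * (\<bar>KG\<bar> * KJ) > 0" using KA KT KJ by (intro add_pos_nonneg) auto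
  ultimately show ?thesis by blast
qed

section \<open>The residual of the Newton equation\<close>

lemma R_block_inverse_mult: "R_block (1 / Rt i) (1 / Rn i) *v (R_block (Rt i) (Rn i) *v x) = x"
  using pos[of i] by (intro vec3_eqI) (simp_all add: R_block_mult)

text \<open>\<open>J *v (v - x)\<close> equals \<open>- (R *v (y v - y x))\<close>, so
  \<open>G\<close> applies \<open>S_block\<close> to the change of \<open>y\<close>. By
  \<open>S_self\<close> its value at \<open>y v\<close> cancels \<open>P (y v)\<close>, which leaves
  the quantity estimated in \<open>S_semismooth\<close>.\<close>

lemma newton_residual_block:
  "contact_block (P (y x) - P (y v) - G v *v (J *v (v - x))) i = R_block (1 / Rt i) (1 / Rn i) *v
     (R_block (Rt i) (Rn i) *v block_proj (\<mu> i) (Rt i) (Rn i) (contact_block (y x) i)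
      - S_block (\<mu> i) (Rt i) (Rn i) (contact_block (y v) i) *v contact_block (y x) i)"
proof -
  let ?a = "contact_block (y v) i" and ?b = "contact_block (y x) i"
  let ?p = "block_proj (\<mu> i) (Rt i) (Rn i)" and ?S = "S_block (\<mu> i) (Rt i) (Rn i) (contact_block (y v) i)"
  let ?N = "R_block (1 / Rt i) (1 / Rn i)"
  have "J *v (v - x) = - (R *v (y v - y x))" by (simp add: R_y_diff)
  then have "contact_block (J *v (v - x)) i = - (R_block (Rt i) (Rn i) *v (?a - ?b))"
    by (simp only: contact_block_minus R_matrix_def contact_block_diag contact_block_diff)
  then have "?N *v contact_block (J *v (v - x)) i = - (?a - ?b)"
    by (simp only: linear_neg[OF matrix_vector_mul_linear] R_block_inverse_mult)
  then have "contact_block (G v *v (J *v (v - x))) i = ?N *v (?S *v (- (?a - ?b)))"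
    by (simp only: G_block)
  also have "\<dots> = - (?N *v (?S *v ?a - ?S *v ?b))"
    by (simp only: linear_neg[OF matrix_vector_mul_linear] matrix_vector_mult_diff_distrib)
  finally have "contact_block (G v *v (J *v (v - x))) i = - (?N *v (?S *v ?a - ?S *v ?b))" .
  moreover have "?N *v (?S *v ?a) = ?p ?a"
    by (simp only: contact.S_self[OF contact] R_block_inverse_mult)
  ultimately show ?thesis
    by (simp add: contact_block_diff cone_proj_eq stacked_proj_block matrix_vector_mult_diff_distrib
        R_block_inverse_mult del: contact_block_component)
qed

lemma newton_residual:
  "cost_gradient v - cost_gradient x - H v *v (v - x) =
     transpose J *v (P (y x) - P (y v) - G v *v (J *v (v - x)))"
  by (simp add: cost_gradient_def H_mult matrix_vector_mult_diff_distrib del: transpose_matrix_vector)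

text \<open>\<open>S_semismooth\<close> is pulled back along the affine map \<open>y\<close>, whose
  Lipschitz constant \<open>KM\<close> turns block distances into \<open>norm (v - x)\<close>, and
  the finitely many block errors are summed.\<close>

lemma H_semismooth:
  "\<exists>C. \<forall>\<^sub>F v in nhds x. norm (cost_gradient v - cost_gradient x - H v *v (v - x)) \<le> C * (norm (v - x))\<^sup>2"
proof -
  let ?b = "\<lambda>v i. contact_block (y v) i"
  let ?e = "\<lambda>v i. S_block (\<mu> i) (Rt i) (Rn i) (?b v i) *v ?b x i
    - R_block (Rt i) (Rn i) *v block_proj (\<mu> i) (Rt i) (Rn i) (?b x i)"
  obtain KT where KT: "0 < KT" "\<And>z. norm (transpose J *v z) \<le> KT * norm z"
    using matrix_bound[of "transpose J"] by blast
  obtain KM where KM: "0 < KM" "\<And>z. norm ((matrix_inv R ** J) *v z) \<le> KM * norm z"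
    using matrix_bound by blast
  have "\<forall>i. \<exists>K>0. \<forall>z. norm (R_block (1 / Rt i) (1 / Rn i) *v z) \<le> K * norm z"
    using matrix_bound by metis
  then obtain KN where KN: "\<And>i. 0 < KN i" "\<And>i z. norm (R_block (1 / Rt i) (1 / Rn i) *v z) \<le> KN i * norm z"
    by metis
  \<comment> \<open>Full rather than punctured neighbourhoods, since blocks of \<open>y v\<close>
    and \<open>y x\<close> may coincide for \<open>v \<noteq> x\<close>.\<close>
  have cont: "filterlim (\<lambda>v. ?b v i) (nhds (?b x i)) (nhds x)" for i
  proof -
    have "isCont y x"
      unfolding y_of_def by (intro continuous_intros bounded_linear.isCont[OF matrix_vector_mul_bounded_linear]
          linear_continuous_at matrix_vector_mul_bounded_linear)
    then have "isCont (\<lambda>v. ?b v i) x"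
      by (rule bounded_linear.isCont[OF bounded_linear_contact_block])
    then show ?thesis
      using tendsto_at_iff_tendsto_nhds[of "\<lambda>v. ?b v i" x] by (simp only: isCont_def)
  qed
  have "\<exists>C. \<forall>\<^sub>F v in nhds x. norm (?e v i) \<le> C * (norm (?b v i - ?b x i))\<^sup>2" for i
  proof -
    from contact.S_semismooth[OF contact, of i "?b x i"] obtain C where
      "\<forall>\<^sub>F z in nhds (?b x i). norm (S_block (\<mu> i) (Rt i) (Rn i) z *v ?b x i
        - R_block (Rt i) (Rn i) *v block_proj (\<mu> i) (Rt i) (Rn i) (?b x i)) \<le> C * (norm (z - ?b x i))\<^sup>2" ..
    from eventually_compose_filterlim[OF this cont] show ?thesis by (rule exI[where x = C])
  qed
  then have "\<forall>i. \<exists>C. \<forall>\<^sub>F v in nhds x. norm (?e v i) \<le> C * (norm (?b v i - ?b x i))\<^sup>2" by (rule allI)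
  from choice[OF this] obtain C where
    C: "\<forall>i. \<forall>\<^sub>F v in nhds x. norm (?e v i) \<le> C i * (norm (?b v i - ?b x i))\<^sup>2" ..
  have "\<forall>\<^sub>F v in nhds x. \<forall>i. norm (?e v i) \<le> C i * (norm (?b v i - ?b x i))\<^sup>2"
    by (rule eventually_all_finite) (rule C[rule_format])
  then have "\<forall>\<^sub>F v in nhds x. norm (cost_gradient v - cost_gradient x - H v *v (v - x))
    \<le> KT * (\<Sum>i\<in>UNIV. KN i * (\<bar>C i\<bar> * KM\<^sup>2)) * (norm (v - x))\<^sup>2"
  proof eventually_elim
    case (elim v)
    have blk: "norm (?e v i) \<le> \<bar>C i\<bar> * (KM * norm (v - x))\<^sup>2" for i
    proof -
      have "norm (?b v i - ?b x i) \<le> norm (y v - y x)"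
        unfolding contact_block_diff[symmetric] by (rule norm_contact_block_le)
      also have "\<dots> \<le> KM * norm (v - x)" using KM(2)[of "v - x"] by (simp only: y_diff norm_minus_cancel)
      finally have "(norm (?b v i - ?b x i))\<^sup>2 \<le> (KM * norm (v - x))\<^sup>2" by (intro power_mono) auto
      then have "\<bar>C i\<bar> * (norm (?b v i - ?b x i))\<^sup>2 \<le> \<bar>C i\<bar> * (KM * norm (v - x))\<^sup>2"
        by (intro mult_left_mono) auto
      moreover have "C i * (norm (?b v i - ?b x i))\<^sup>2 \<le> \<bar>C i\<bar> * (norm (?b v i - ?b x i))\<^sup>2"
        by (intro mult_right_mono) auto
      ultimately show ?thesis using elim by (meson order_trans)
    qed
    have "norm (contact_block (P (y x) - P (y v) - G v *v (J *v (v - x))) i)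
      \<le> KN i * (\<bar>C i\<bar> * (KM * norm (v - x))\<^sup>2)" for i
    proof -
      have "norm (contact_block (P (y x) - P (y v) - G v *v (J *v (v - x))) i) \<le> KN i * norm (?e v i)"
        unfolding newton_residual_block norm_minus_commute[of "S_block _ _ _ _ *v _"] by (rule KN(2))
      also have "\<dots> \<le> KN i * (\<bar>C i\<bar> * (KM * norm (v - x))\<^sup>2)"
        using blk KN(1)[of i] by (intro mult_left_mono) auto
      finally show ?thesis .
    qed
    then have "norm (P (y x) - P (y v) - G v *v (J *v (v - x)))
      \<le> (\<Sum>i\<in>UNIV. KN i * (\<bar>C i\<bar> * (KM * norm (v - x))\<^sup>2))"
      by (intro order_trans[OF norm_le_sum_blocks] sum_mono)
    then have "norm (cost_gradient v - cost_gradient x - H v *v (v - x))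
      \<le> KT * (\<Sum>i\<in>UNIV. KN i * (\<bar>C i\<bar> * (KM * norm (v - x))\<^sup>2))"
      unfolding newton_residual using KT by (meson mult_left_mono less_imp_le order_trans)
    then show ?case by (simp add: power_mult_distrib sum_distrib_right sum_distrib_left mult_ac)
  qed
  then show ?thesis by (rule exI[where x = "KT * (\<Sum>i\<in>UNIV. KN i * (\<bar>C i\<bar> * KM\<^sup>2))"])
qed

section \<open>Convergence of the SAP iterates\<close>

lemma sap_converges:
  fixes v0 :: "real ^ 'n"
  defines "v_min \<equiv> arg_min cost (\<lambda>_. True)" and "x \<equiv> sap_iter A J v_free vc_hat \<mu> Rt Rn v0"
  shows "x \<longlonglongrightarrow> v_min"
    and "\<exists>M. \<exists>\<zeta>>0. \<forall>m>M. norm (x (Suc m) - v_min) \<le> \<zeta> * (norm (x m - v_min))\<^sup>2"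
proof -
  obtain \<sigma> L where \<sigma>: "\<And>z. \<sigma> * (norm z)\<^sup>2 \<le> z \<bullet> (A *v z)"
    and smooth: "strongly_convex_smooth cost cost_gradient \<sigma> L" using cost_bounds by blast
  obtain K where K: "0 < K" "\<And>v z. norm (H v *v z) \<le> K * norm z" using H_bounded by blast
  interpret strongly_convex_smooth cost cost_gradient \<sigma> L by (rule smooth)
  interpret newton_line_search cost cost_gradient \<sigma> L H K
    by unfold_locales (rule K order_trans[OF \<sigma> H_coercive])+
  \<comment> \<open>\<open>gradient_f\<close> identifies the gradient in \<open>sap_step\<close>
    with \<open>cost_gradient\<close>.\<close>
  have iter: "x (Suc m) = step (x m)" for m
    by (simp add: x_def sap_step_def step_def direction_def gradient_f Let_def)
  have min: "v_min = minimizer" by (simp add: v_min_def minimizer_def)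
  show "x \<longlonglongrightarrow> v_min" unfolding min by (rule iterates_converge) (rule iter)
  obtain C where "\<forall>\<^sub>F v in nhds minimizer.
      norm (cost_gradient v - cost_gradient minimizer - H v *v (v - minimizer)) \<le> C * (norm (v - minimizer))\<^sup>2"
    using H_semismooth by blast
  \<comment> \<open>The gradient vanishes at the minimizer, so the semismoothness estimate becomes
    the residual bound of \<open>iterates_quadratic\<close>.\<close>
  then have "\<forall>\<^sub>F v in nhds minimizer.
      norm (cost_gradient v - H v *v (v - minimizer)) \<le> C * (norm (v - minimizer))\<^sup>2"
    by (simp add: gradient_minimizer)
  then show "\<exists>M. \<exists>\<zeta>>0. \<forall>m>M. norm (x (Suc m) - v_min) \<le> \<zeta> * (norm (x m - v_min))\<^sup>2"
    unfolding min by (rule iterates_quadratic[rotated]) (rule iter)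
qed

end


theorem theorem3:
  fixes A :: "real ^ 'n ^ 'n"
    and J :: "real ^ 'n ^ ('c::finite \<times> 3)"
    and v_free :: "real ^ 'n"
    and vc_hat :: "real ^ ('c \<times> 3)"
    and \<mu> Rt Rn :: "'c \<Rightarrow> real"
    and v_min :: "real ^ 'n"
  assumes "sym_pos_def A"
    and "\<And>i. 0 < \<mu> i"
    and "\<And>i. 0 < Rt i"
    and "\<And>i. 0 < Rn i"
    and "v_min = arg_min (primal_cost A J v_free vc_hat \<mu> Rt Rn) (\<lambda>_. True)"
  shows "(\<forall>v0. sap_iter A J v_free vc_hat \<mu> Rt Rn v0 \<longlonglongrightarrow> v_min) \<and>
    (\<forall>r>0. gradient (primal_cost A J v_free vc_hat \<mu> Rt Rn) differentiable_on cball v_min r \<longrightarrow>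
      (\<forall>v0. \<exists>M. \<exists>\<zeta>>0. \<forall>m>M.
         norm (sap_iter A J v_free vc_hat \<mu> Rt Rn v0 (Suc m) - v_min)
           \<le> \<zeta> * (norm (sap_iter A J v_free vc_hat \<mu> Rt Rn v0 m - v_min))\<^sup>2))"
proof -
  interpret sap_problem A J v_free vc_hat \<mu> Rt Rn using assms by unfold_locales auto
  show ?thesis unfolding assms(5) by (intro conjI allI impI sap_converges)
qed

end
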